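(* Suppose $S=\bigcup_{k=1}^m T_k\subseteq\mathbb{R}^n$ is a compact convex semialgebraic set, where each $$T_k=\{x\in\mathbb{R}^n:\ g^k_1(x)\ge 0,\dots,g^k_{m_k}(x)\ge 0\}$$ is defined by polynomials $g^k_i$. If for every $u\in\partial S$ and each $g^k_i$ satisfying $g^k_i(u)=0$, the set $T_k$ has interior near $u$ and $g^k_i$ is either sos-concave or strictly quasi-concave at $u$, then $S$ is SDP representable.
   Context: A set $S\subseteq\mathbb{R}^n$ is SDP representable if there are $N\ge 0$ and real symmetric matrices $A_0,A_1,\dots,A_n,B_1,\dots,B_N$ of a common size such that $S=\{x\in\mathbb{R}^n:\exists u\in\mathbb{R}^N,\ A_0+\sum_{i=1}^n x_iA_i+\sum_{j=1}^N u_jB_j\succeq 0\}$, where $\succeq 0$ means positive semidefinite. $\partial S$ is the topological boundary. The set $T_k$ has interior near $u$ if for every sufficiently small $\delta>0$ there exists $v$ with $\|v-u\|<\delta$ and $g^k_i(v)>0$ for all $i=1,\dots,m_k$. The sets $T_k$ are not assumed convex. A polynomial $g$ is sos-concave if $-\nabla^2 g(x)=W(x)^TW(x)$ for some (possibly nonsquare) matrix polynomial $W(x)$. A smooth function $f$ is strictly quasi-concave at $u$ if $-v^T\nabla^2 f(u)v>0$ for all $0\ne v\in\mathbb{R}^n$ with $\nabla f(u)^Tv=0$ (in particular, if $\nabla f(u)=0$, this requires $-\nabla^2 f(u)$ to be positive definite). *)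

theory Defs
  imports "HOL-Analysis.Analysis"
begin

(* Polynomials in n real variables are represented by the functions they induce on real^'n,
   i.e. by real_polynomial_function; over the reals this loses nothing. *)

definition grad :: "(real^'n \<Rightarrow> real) \<Rightarrow> real^'n \<Rightarrow> real^'n" where
  "grad f x = (\<chi> i. frechet_derivative f (at x) (axis i 1))"

definition hessian :: "(real^'n \<Rightarrow> real) \<Rightarrow> real^'n \<Rightarrow> real^'n^'n" where
  "hessian f x = jacobian (grad f) (at x)"

(* W is a matrix polynomial with r rows, its entry in row l and column i being W l i. *)
definition sos_concave :: "(real^'n \<Rightarrow> real) \<Rightarrow> bool" where
  "sos_concave f \<longleftrightarrow>
     (\<exists>(r::nat) (W :: nat \<Rightarrow> 'n \<Rightarrow> real^'n \<Rightarrow> real).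
        (\<forall>l<r. \<forall>i. real_polynomial_function (W l i)) \<and>
        (\<forall>x i j. (- hessian f x) $ i $ j = (\<Sum>l<r. W l i x * W l j x)))"

definition strictly_quasi_concave_at :: "(real^'n \<Rightarrow> real) \<Rightarrow> real^'n \<Rightarrow> bool" where
  "strictly_quasi_concave_at f u \<longleftrightarrow>
     (\<forall>v. v \<noteq> 0 \<longrightarrow> grad f u \<bullet> v = 0 \<longrightarrow> - (v \<bullet> (hessian f u *v v)) > 0)"

definition basic_closed_set :: "nat \<Rightarrow> (nat \<Rightarrow> real^'n \<Rightarrow> real) \<Rightarrow> (real^'n) set" where
  "basic_closed_set l h = {x. \<forall>i\<in>{1..l}. h i x \<ge> 0}"

(* A property of the describing functions h 1, ..., h l, not only of the set they define. *)
definition has_interior_near :: "nat \<Rightarrow> (nat \<Rightarrow> real^'n \<Rightarrow> real) \<Rightarrow> real^'n \<Rightarrow> bool" where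
  "has_interior_near l h u \<longleftrightarrow>
     (\<forall>\<^sub>F \<delta> in at_right (0::real). \<exists>v. norm (v - u) < \<delta> \<and> (\<forall>i\<in>{1..l}. h i v > 0))"

inductive semialgebraic :: "(real^'n) set \<Rightarrow> bool" where
  semialgebraic_pos: "real_polynomial_function p \<Longrightarrow> semialgebraic {x. p x > 0}"
| semialgebraic_Compl: "semialgebraic A \<Longrightarrow> semialgebraic (- A)"
| semialgebraic_Un: "semialgebraic A \<Longrightarrow> semialgebraic B \<Longrightarrow> semialgebraic (A \<union> B)"

(* The size d of the matrices below is existentially quantified, so they are functions
   nat => nat => real of which only the entries with both indices below d matter. *)

definition symmetric_upto :: "nat \<Rightarrow> (nat \<Rightarrow> nat \<Rightarrow> real) \<Rightarrow> bool" where
  "symmetric_upto d M \<longleftrightarrow> (\<forall>r<d. \<forall>s<d. M r s = M s r)"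

definition psd_upto :: "nat \<Rightarrow> (nat \<Rightarrow> nat \<Rightarrow> real) \<Rightarrow> bool" where
  "psd_upto d M \<longleftrightarrow> symmetric_upto d M \<and>
     (\<forall>z :: nat \<Rightarrow> real. (\<Sum>r<d. \<Sum>s<d. z r * M r s * z s) \<ge> 0)"

definition sdp_representable :: "(real^'n) set \<Rightarrow> bool" where
  "sdp_representable S \<longleftrightarrow>
     (\<exists>(d::nat) (N::nat) A0 (A :: 'n \<Rightarrow> nat \<Rightarrow> nat \<Rightarrow> real) (B :: nat \<Rightarrow> nat \<Rightarrow> nat \<Rightarrow> real).
        symmetric_upto d A0 \<and>
        (\<forall>i. symmetric_upto d (A i)) \<and>
        (\<forall>j\<in>{1..N}. symmetric_upto d (B j)) \<and>
        S = {x. \<exists>u :: nat \<Rightarrow> real.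
                  psd_upto d (\<lambda>r s. A0 r s + (\<Sum>i\<in>UNIV. x $ i * A i r s)
                                         + (\<Sum>j\<in>{1..N}. u j * B j r s))})"

end

(* The boundary of S is covered by finitely many sets K = T_k \<inter> cball u \<delta> with u in the boundary
   and \<delta> small, and S is the convex hull of their union by Krein-Milman. Each K is exactly
   described by a truncated moment relaxation: if L is a linear functional with L 1 = 1, nonnegative
   on squares of bounded degree, and a is its barycentre, then L h \<le> h a (Jensen) as soon as L does
   not see a positive second derivative of h along the segments issuing from a. This holds for
   sos-concave h, and also for h with negative definite Hessian at u provided that L is in addition
   nonnegative on squares times \<delta>^2 - |x - u|^2, since the Hessian is then nearly constant. A strictly
   quasi-concave g with g u = 0 is replaced by h = g - c g^2 with c large (Finsler's lemma). Finally,
   one homogenized functional per set K, with total mass one, describes the convex hull by a linear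
   matrix inequality in the moments. *)
theory Submission
  imports Defs "HOL-Library.Function_Algebras" "HOL-Computational_Algebra.Polynomial"
begin

section \<open>Linear matrix inequalities\<close>

text \<open>The obstacle is uniformity. The barycentre \<open>a\<close> is itself an unknown of the
  linear matrix inequality, so Jensen's inequality must hold with one relaxation order for all
  feasible \<open>L\<close>, all \<open>a\<close> and all points \<open>a + t (x - a)\<close> of the
  segments. In the sos-concave case this is automatic, since substituting an affine line does not
  raise the degree of \<open>W\<close>. For a Hessian definite at \<open>u\<close>, the deviation of
  its entries from their values at \<open>u\<close> is bounded by explicit identities between
  squares, composed along the construction of a polynomial from coordinates; orders and radii thus
  come out of an induction. The error is absorbed by half of the definiteness
  \<open>\<epsilon>\<close>, both being measured against the second moments of \<open>L\<close>
  around \<open>a\<close>.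

  Passing from \<open>g\<close> to \<open>g - c g^2 = g (1 - c g)\<close> multiplies by a factor
  that is positive near \<open>u\<close>, hence keeps the set there, but subtracts
  \<open>2 c\<close> times the square of the gradient form from the Hessian form at
  \<open>u\<close>. This corrects exactly the directions about which strict quasi-concavity says
  nothing.

  The functionals need not come from measures and carry no continuity; all limits are taken in the
  single real variable \<open>t\<close>.\<close>

definition aff :: "'j set \<Rightarrow> (real^'n \<Rightarrow> ('j \<Rightarrow> real) \<Rightarrow> real) \<Rightarrow> bool" where
  "aff J f \<longleftrightarrow> (\<exists>c0 c b. \<forall>x u. f x u = c0 + (\<Sum>i\<in>UNIV. x $ i * c i) + (\<Sum>j\<in>J. u j * b j))"

text \<open>Lifting variables may be indexed by any set \<open>J\<close>, and the matrix size is
  hidden. Constraints can then be assembled as predicates, and numbering is postponed to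
  \<open>lmi_imp_sdp_representable\<close>.\<close>

definition lmi :: "'j set \<Rightarrow> (real^'n \<Rightarrow> ('j \<Rightarrow> real) \<Rightarrow> bool) \<Rightarrow> bool" where
  "lmi J P \<longleftrightarrow> (\<exists>d A0 A B. symmetric_upto d A0 \<and> (\<forall>i. symmetric_upto d (A i)) \<and>
     (\<forall>j\<in>J. symmetric_upto d (B j)) \<and>
     (\<forall>x u. P x u \<longleftrightarrow> psd_upto d (\<lambda>r s. A0 r s + (\<Sum>i\<in>UNIV. x $ i * A i r s)
                                                + (\<Sum>j\<in>J. u j * B j r s))))"

lemma aff_const: "aff J (\<lambda>x u. c)"
  unfolding aff_def by (rule exI[of _ c], rule exI[of _ "\<lambda>_. 0"], rule exI[of _ "\<lambda>_. 0"]) simp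

lemma aff_coord: "aff J (\<lambda>x u. x $ i)"
  unfolding aff_def
  by (rule exI[of _ 0], rule exI[of _ "\<lambda>k. if k = i then 1 else 0"], rule exI[of _ "\<lambda>_. 0"])
     (simp add: if_distrib cong: if_cong)

lemma aff_var:
  assumes "finite J" "j \<in> J" shows "aff J (\<lambda>x u. u j)"
  unfolding aff_def
  by (rule exI[of _ 0], rule exI[of _ "\<lambda>_. 0"], rule exI[of _ "\<lambda>k. if k = j then 1 else 0"])
     (simp add: assms if_distrib cong: if_cong)

lemma aff_add:
  assumes "aff J f" "aff J g" shows "aff J (\<lambda>x u. f x u + g x u)"
proof -
  obtain c0 c b where f: "\<And>x u. f x u = c0 + (\<Sum>i\<in>UNIV. x $ i * c i) + (\<Sum>j\<in>J. u j * b j)"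
    using assms(1) unfolding aff_def by metis
  obtain c0' c' b' where g: "\<And>x u. g x u = c0' + (\<Sum>i\<in>UNIV. x $ i * c' i) + (\<Sum>j\<in>J. u j * b' j)"
    using assms(2) unfolding aff_def by metis
  show ?thesis unfolding aff_def
    by (rule exI[of _ "c0 + c0'"], rule exI[of _ "\<lambda>i. c i + c' i"], rule exI[of _ "\<lambda>j. b j + b' j"])
       (simp add: f g distrib_left sum.distrib)
qed

lemma aff_scale:
  assumes "aff J f" shows "aff J (\<lambda>x u. k * f x u)"
proof -
  obtain c0 c b where f: "\<And>x u. f x u = c0 + (\<Sum>i\<in>UNIV. x $ i * c i) + (\<Sum>j\<in>J. u j * b j)"
    using assms unfolding aff_def by metis
  show ?thesis unfolding aff_def
    by (rule exI[of _ "k * c0"], rule exI[of _ "\<lambda>i. k * c i"], rule exI[of _ "\<lambda>j. k * b j"])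
       (simp add: f distrib_left sum_distrib_left mult.left_commute)
qed

lemma aff_sum:
  assumes "finite I" "\<And>i. i \<in> I \<Longrightarrow> aff J (f i)" shows "aff J (\<lambda>x u. \<Sum>i\<in>I. f i x u)"
  using assms by (induction I rule: finite_induct) (auto intro: aff_const aff_add)

lemma sum2_reindex:
  assumes "bij_betw h A B"
  shows "(\<Sum>r\<in>A. \<Sum>s\<in>A. f (h r) (h s)) = (\<Sum>r\<in>B. \<Sum>s\<in>B. f r s)"
proof -
  have "(\<Sum>r\<in>A. \<Sum>s\<in>A. f (h r) (h s)) = (\<Sum>r\<in>A. \<Sum>s\<in>B. f (h r) s)"
    by (intro sum.cong refl sum.reindex_bij_betw[OF assms])
  then show ?thesis using sum.reindex_bij_betw[OF assms, of "\<lambda>r. \<Sum>s\<in>B. f r s"] by simp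
qed

lemma lmi_psd:
  fixes F :: "'r \<Rightarrow> 'r \<Rightarrow> real^'n \<Rightarrow> ('j \<Rightarrow> real) \<Rightarrow> real"
  assumes fin: "finite R" and sym: "\<And>r s. r \<in> R \<Longrightarrow> s \<in> R \<Longrightarrow> F r s = F s r"
    and aff: "\<And>r s. r \<in> R \<Longrightarrow> s \<in> R \<Longrightarrow> aff J (F r s)"
  shows "lmi J (\<lambda>x u. \<forall>z. 0 \<le> (\<Sum>r\<in>R. \<Sum>s\<in>R. z r * F r s x u * z s))"
proof -
  \<comment> \<open>The coefficients are chosen as a function \<open>K\<close> of the entry itself
    and not of its index pair. Entries in symmetric positions are equal functions, so the
    coefficient matrices are symmetric without any uniqueness argument.\<close>
  have "\<forall>f\<in>{f :: real^'n \<Rightarrow> ('j \<Rightarrow> real) \<Rightarrow> real. aff J f}. \<exists>k. \<forall>x u.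
      f x u = fst k + (\<Sum>i\<in>UNIV. x $ i * fst (snd k) i) + (\<Sum>j\<in>J. u j * snd (snd k) j)"
    unfolding aff_def by auto
  from bchoice[OF this] obtain K where K0: "\<forall>f\<in>{f :: real^'n \<Rightarrow> ('j \<Rightarrow> real) \<Rightarrow> real. aff J f}. \<forall>x u.
      f x u = fst (K f) + (\<Sum>i\<in>UNIV. x $ i * fst (snd (K f)) i) + (\<Sum>j\<in>J. u j * snd (snd (K f)) j)"
    by blast
  have K: "f x u = fst (K f) + (\<Sum>i\<in>UNIV. x $ i * fst (snd (K f)) i) + (\<Sum>j\<in>J. u j * snd (snd (K f)) j)"
    if "aff J f" for f x u
    using K0 that by blast
  obtain h where h: "bij_betw h {..<card R} R"
    using ex_bij_betw_nat_finite[OF fin] by (auto simp: atLeast0LessThan)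
  have hR: "h r \<in> R" if "r < card R" for r using h that by (auto simp: bij_betw_def)
  let ?d = "card R"
  have eq: "(\<forall>z. 0 \<le> (\<Sum>r\<in>R. \<Sum>s\<in>R. z r * F r s x u * z s)) \<longleftrightarrow>
      (\<forall>z. 0 \<le> (\<Sum>r<?d. \<Sum>s<?d. z r * F (h r) (h s) x u * z s))" (is "?L \<longleftrightarrow> ?R") for x u
  proof
    assume L: ?L
    show ?R
    proof
      fix z
      have "(\<Sum>r<?d. \<Sum>s<?d. z r * F (h r) (h s) x u * z s) =
        (\<Sum>r<?d. \<Sum>s<?d. z (inv_into {..<?d} h (h r)) * F (h r) (h s) x u * z (inv_into {..<?d} h (h s)))"
        using h by (intro sum.cong refl) (simp add: bij_betw_inv_into_left)
      also have "\<dots> = (\<Sum>r\<in>R. \<Sum>s\<in>R. z (inv_into {..<?d} h r) * F r s x u * z (inv_into {..<?d} h s))"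
        by (rule sum2_reindex[OF h, of "\<lambda>r s. z (inv_into {..<?d} h r) * F r s x u * z (inv_into {..<?d} h s)"])
      finally show "0 \<le> (\<Sum>r<?d. \<Sum>s<?d. z r * F (h r) (h s) x u * z s)"
        using L[rule_format, of "\<lambda>r. z (inv_into {..<?d} h r)"] by simp
    qed
  next
    assume R: ?R
    show ?L
    proof
      fix z
      show "0 \<le> (\<Sum>r\<in>R. \<Sum>s\<in>R. z r * F r s x u * z s)"
        using R[rule_format, of "\<lambda>r. z (h r)"] sum2_reindex[OF h, of "\<lambda>r s. z r * F r s x u * z s"] by simp
    qed
  qed
  let ?K = "\<lambda>r s. K (F (h r) (h s))"
  have Fsym: "F (h r) (h s) = F (h s) (h r)" if "r < ?d" "s < ?d" for r s
    using sym hR that by simp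
  have form: "F (h r) (h s) x u = fst (?K r s) + (\<Sum>i\<in>UNIV. x $ i * fst (snd (?K r s)) i) +
      (\<Sum>j\<in>J. u j * snd (snd (?K r s)) j)" if "r < ?d" "s < ?d" for r s x u
    using K[OF aff] hR that by blast
  show ?thesis unfolding lmi_def
  proof (intro exI conjI allI ballI)
    show "symmetric_upto ?d (\<lambda>r s. fst (?K r s))"
      unfolding symmetric_upto_def using Fsym by simp
    show "symmetric_upto ?d (\<lambda>r s. fst (snd (?K r s)) i)" for i
      unfolding symmetric_upto_def using Fsym by simp
    show "symmetric_upto ?d (\<lambda>r s. snd (snd (?K r s)) j)" for j
      unfolding symmetric_upto_def using Fsym by simp
    fix x :: "real^'n" and u :: "'j \<Rightarrow> real"
    let ?M = "\<lambda>r s. fst (?K r s) + (\<Sum>i\<in>UNIV. x $ i * fst (snd (?K r s)) i) +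
      (\<Sum>j\<in>J. u j * snd (snd (?K r s)) j)"
    have "symmetric_upto ?d ?M" unfolding symmetric_upto_def using Fsym by simp
    moreover have "(\<Sum>r<?d. \<Sum>s<?d. z r * ?M r s * z s) = (\<Sum>r<?d. \<Sum>s<?d. z r * F (h r) (h s) x u * z s)" for z
      by (intro sum.cong refl) (simp add: form)
    ultimately show "(\<forall>z. 0 \<le> (\<Sum>r\<in>R. \<Sum>s\<in>R. z r * F r s x u * z s)) \<longleftrightarrow> psd_upto ?d ?M"
      unfolding eq psd_upto_def by simp
  qed
qed

lemma lmi_nonneg:
  assumes "aff J f" shows "lmi J (\<lambda>x u. 0 \<le> f x u)"
proof -
  have "lmi J (\<lambda>x u. \<forall>z. 0 \<le> (\<Sum>r\<in>{()}. \<Sum>s\<in>{()}. z r * f x u * z s))"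
    using assms by (intro lmi_psd) auto
  moreover have "(\<forall>z. 0 \<le> (\<Sum>r\<in>{()}. \<Sum>s\<in>{()}. z r * f x u * z s)) \<longleftrightarrow> 0 \<le> f x u" for x u
  proof
    assume "\<forall>z. 0 \<le> (\<Sum>r\<in>{()}. \<Sum>s\<in>{()}. z r * f x u * z s)"
    from this[rule_format, of "\<lambda>_. 1"] show "0 \<le> f x u" by simp
  next
    assume "0 \<le> f x u"
    then show "\<forall>z. 0 \<le> (\<Sum>r\<in>{()}. \<Sum>s\<in>{()}. z r * f x u * z s)"
      by (simp add: mult.commute[of _ "f x u"] mult.assoc)
  qed
  ultimately show ?thesis by simp
qed

text \<open>Block diagonal sum, indexed by the disjoint union of the two row sets; vectors supported
  on one block recover each condition separately.\<close>

lemma lmi_conj: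
  assumes "lmi J P" "lmi J Q" shows "lmi J (\<lambda>x u. P x u \<and> Q x u)"
proof -
  obtain d A0 A B where P: "symmetric_upto d A0" "\<forall>i. symmetric_upto d (A i)" "\<forall>j\<in>J. symmetric_upto d (B j)"
     "\<forall>x u. P x u \<longleftrightarrow> psd_upto d (\<lambda>r s. A0 r s + (\<Sum>i\<in>UNIV. x $ i * A i r s) + (\<Sum>j\<in>J. u j * B j r s))"
    using assms(1) unfolding lmi_def by (elim exE conjE) (rule that)
  obtain d' A0' A' B' where Q: "symmetric_upto d' A0'" "\<forall>i. symmetric_upto d' (A' i)" "\<forall>j\<in>J. symmetric_upto d' (B' j)"
     "\<forall>x u. Q x u \<longleftrightarrow> psd_upto d' (\<lambda>r s. A0' r s + (\<Sum>i\<in>UNIV. x $ i * A' i r s) + (\<Sum>j\<in>J. u j * B' j r s))"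
    using assms(2) unfolding lmi_def by (elim exE conjE) (rule that)
  define M where "M r s x u = A0 r s + (\<Sum>i\<in>UNIV. x $ i * A i r s) + (\<Sum>j\<in>J. u j * B j r s)" for r s x u
  define M' where "M' r s x u = A0' r s + (\<Sum>i\<in>UNIV. x $ i * A' i r s) + (\<Sum>j\<in>J. u j * B' j r s)" for r s x u
  have Ms: "M r s = M s r" if "r < d" "s < d" for r s
    unfolding M_def using P(1-3) that by (intro ext) (simp add: symmetric_upto_def)
  have Ms': "M' r s = M' s r" if "r < d'" "s < d'" for r s
    unfolding M'_def using Q(1-3) that by (intro ext) (simp add: symmetric_upto_def)
  have PM: "P x u \<longleftrightarrow> (\<forall>z. 0 \<le> (\<Sum>r<d. \<Sum>s<d. z r * M r s x u * z s))" for x u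
    unfolding P(4)[rule_format] psd_upto_def M_def[symmetric] using Ms by (simp add: symmetric_upto_def)
  have QM: "Q x u \<longleftrightarrow> (\<forall>z. 0 \<le> (\<Sum>r<d'. \<Sum>s<d'. z r * M' r s x u * z s))" for x u
    unfolding Q(4)[rule_format] psd_upto_def M'_def[symmetric] using Ms' by (simp add: symmetric_upto_def)
  define F where "F = case_sum (\<lambda>r. case_sum (\<lambda>s. M r s) (\<lambda>s x u. 0)) (\<lambda>r. case_sum (\<lambda>s x u. 0) (\<lambda>s. M' r s))"
  have split: "(\<Sum>r\<in>{..<d}<+>{..<d'}. \<Sum>s\<in>{..<d}<+>{..<d'}. z r * F r s x u * z s) =
     (\<Sum>r<d. \<Sum>s<d. z (Inl r) * M r s x u * z (Inl s)) + (\<Sum>r<d'. \<Sum>s<d'. z (Inr r) * M' r s x u * z (Inr s))" for x u z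
    by (simp add: sum.Plus F_def)
  have "lmi J (\<lambda>x u. \<forall>z. 0 \<le> (\<Sum>r\<in>{..<d}<+>{..<d'}. \<Sum>s\<in>{..<d}<+>{..<d'}. z r * F r s x u * z s))"
  proof (rule lmi_psd)
    show "F r s = F s r" if "r \<in> {..<d}<+>{..<d'}" "s \<in> {..<d}<+>{..<d'}" for r s
      using that by (auto simp: F_def Ms Ms')
    have "aff J (M r s)" for r s
      unfolding M_def aff_def by (intro exI allI) (rule refl)
    moreover have "aff J (M' r s)" for r s
      unfolding M'_def aff_def by (intro exI allI) (rule refl)
    ultimately show "aff J (F r s)" for r s
      by (cases r; cases s) (auto simp: F_def aff_const)
  qed simp
  moreover have "(\<forall>z. 0 \<le> (\<Sum>r\<in>{..<d}<+>{..<d'}. \<Sum>s\<in>{..<d}<+>{..<d'}. z r * F r s x u * z s)) \<longleftrightarrow> P x u \<and> Q x u" for x u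
  proof
    assume L: "\<forall>z. 0 \<le> (\<Sum>r\<in>{..<d}<+>{..<d'}. \<Sum>s\<in>{..<d}<+>{..<d'}. z r * F r s x u * z s)"
    show "P x u \<and> Q x u" unfolding PM QM
    proof (intro conjI allI)
      show "0 \<le> (\<Sum>r<d. \<Sum>s<d. z r * M r s x u * z s)" for z
        using L[rule_format, of "case_sum z (\<lambda>_. 0)"] unfolding split by simp
      show "0 \<le> (\<Sum>r<d'. \<Sum>s<d'. z r * M' r s x u * z s)" for z
        using L[rule_format, of "case_sum (\<lambda>_. 0) z"] unfolding split by simp
    qed
  next
    assume "P x u \<and> Q x u"
    then show "\<forall>z. 0 \<le> (\<Sum>r\<in>{..<d}<+>{..<d'}. \<Sum>s\<in>{..<d}<+>{..<d'}. z r * F r s x u * z s)"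
      unfolding split PM QM by (auto intro!: add_nonneg_nonneg)
  qed
  ultimately show ?thesis by simp
qed

lemma lmi_Ball:
  assumes "finite I" "\<And>i. i \<in> I \<Longrightarrow> lmi J (P i)"
  shows "lmi J (\<lambda>x u. \<forall>i\<in>I. P i x u)"
  using assms
proof (induction I rule: finite_induct)
  case empty
  show ?case using lmi_nonneg[OF aff_const[of J 0]] by simp
next
  case (insert i I)
  then have "lmi J (\<lambda>x u. P i x u \<and> (\<forall>i\<in>I. P i x u))" by (intro lmi_conj) auto
  then show ?case by simp
qed

lemma lmi_eq:
  assumes "aff J f" "aff J g" shows "lmi J (\<lambda>x u. f x u = g x u)"
proof -
  have "lmi J (\<lambda>x u. 0 \<le> f x u + (-1) * g x u \<and> 0 \<le> g x u + (-1) * f x u)"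
    using assms by (intro lmi_conj lmi_nonneg aff_add aff_scale)
  moreover have "(\<lambda>x u. 0 \<le> f x u + (-1) * g x u \<and> 0 \<le> g x u + (-1) * f x u) = (\<lambda>x u. f x u = g x u)"
    by (auto simp: fun_eq_iff)
  ultimately show ?thesis by simp
qed

lemma lmi_imp_sdp_representable:
  assumes "finite J" "lmi J P"
  shows "sdp_representable {x. \<exists>u. P x u}"
proof -
  obtain d A0 A B where P: "symmetric_upto d A0" "\<forall>i. symmetric_upto d (A i)" "\<forall>j\<in>J. symmetric_upto d (B j)"
     "\<forall>x u. P x u \<longleftrightarrow> psd_upto d (\<lambda>r s. A0 r s + (\<Sum>i\<in>UNIV. x $ i * A i r s) + (\<Sum>j\<in>J. u j * B j r s))"
    using assms(2) unfolding lmi_def by (elim exE conjE) (rule that)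
  obtain h where h: "bij_betw h {1..card J} J"
    using finite_same_card_bij[of "{1..card J}" J] assms(1) by auto
  have re: "(\<Sum>j\<in>{1..card J}. u (h j) * B (h j) r s) = (\<Sum>j\<in>J. u j * B j r s)" for u r s
    by (rule sum.reindex_bij_betw[OF h, of "\<lambda>j. u j * B j r s"])
  show ?thesis unfolding sdp_representable_def
  proof (intro exI conjI allI ballI)
    show "symmetric_upto d (B (h j))" if "j \<in> {1..card J}" for j
      using P(3) h that by (auto simp: bij_betw_def)
    have "(\<exists>u. P x u) \<longleftrightarrow> (\<exists>u. psd_upto d (\<lambda>r s. A0 r s + (\<Sum>i\<in>UNIV. x $ i * A i r s)
        + (\<Sum>j\<in>{1..card J}. u j * B (h j) r s)))" (is "?L \<longleftrightarrow> ?R") for x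
    proof
      assume ?L
      then obtain u where "P x u" by blast
      then show ?R unfolding P(4)[rule_format] re[symmetric] by (rule exI[of _ "\<lambda>j. u (h j)"])
    next
      assume ?R
      then obtain u where u: "psd_upto d (\<lambda>r s. A0 r s + (\<Sum>i\<in>UNIV. x $ i * A i r s)
        + (\<Sum>j\<in>{1..card J}. u j * B (h j) r s))" by blast
      have "(\<Sum>j\<in>{1..card J}. u j * B (h j) r s) = (\<Sum>j\<in>J. u (inv_into {1..card J} h j) * B j r s)" for r s
        unfolding re[symmetric] using h
        by (intro sum.cong refl) (simp add: bij_betw_inv_into_left)
      with u have "P x (\<lambda>j. u (inv_into {1..card J} h j))" unfolding P(4)[rule_format] by simp
      then show ?L by blast
    qed
    then show "{x. \<exists>u. P x u} = {x. \<exists>u. psd_upto d (\<lambda>r s. A0 r s + (\<Sum>i\<in>UNIV. x $ i * A i r s)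
        + (\<Sum>j\<in>{1..card J}. u j * B (h j) r s))}" by simp
  qed (use P in auto)
qed

section \<open>Linear functionals on polynomials and moment relaxations\<close>

text \<open>Functionals on all real functions, not only on polynomials of some degree: any
  expression in \<open>x\<close> may stand under \<open>L\<close> without a membership condition,
  and degrees enter only through the squares on which \<open>L\<close> is required to be
  nonnegative.\<close>

definition lin :: "(('a \<Rightarrow> real) \<Rightarrow> real) \<Rightarrow> bool" where
  "lin L \<longleftrightarrow> (\<forall>f g. L (\<lambda>x. f x + g x) = L f + L g) \<and> (\<forall>c f. L (\<lambda>x. c * f x) = c * L f)"

lemma lin_add: "lin L \<Longrightarrow> L (\<lambda>x. f x + g x) = L f + L g"
  and lin_scale: "lin L \<Longrightarrow> L (\<lambda>x. c * f x) = c * L f"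
  unfolding lin_def by blast+

lemma lin_zero: "lin L \<Longrightarrow> L (\<lambda>x. 0) = 0"
  using lin_scale[of L 0 "\<lambda>x. 0"] by simp

lemma lin_diff: "lin L \<Longrightarrow> L (\<lambda>x. f x - g x) = L f - L g"
  using lin_add[of L f "\<lambda>x. (-1) * g x"] lin_scale[of L "-1" g] by simp

lemma lin_sum:
  assumes "lin L" shows "L (\<lambda>x. \<Sum>i\<in>I. f i x) = (\<Sum>i\<in>I. L (f i))"
  by (induction I rule: infinite_finite_induct) (simp_all add: lin_zero[OF assms] lin_add[OF assms])

lemma lin_eval: "lin (\<lambda>f. c * f a)"
  by (simp add: lin_def algebra_simps)

text \<open>Replaces a functional by finitely many real variables. Values on \<open>B\<close>
  determine those on \<open>E\<close> linearly, and, \<open>B\<close> being independent, arbitrary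
  values on \<open>B\<close> extend to a functional; so the values on \<open>B\<close> can serve as
  unconstrained lifting variables.\<close>

lemma basis_of_finite_functions:
  fixes E :: "('a \<Rightarrow> real) set"
  assumes "finite E"
  obtains B k where "B \<subseteq> E" "\<And>f x. f \<in> E \<Longrightarrow> f x = (\<Sum>e\<in>B. k f e * e x)"
    "\<And>y. \<exists>L. lin L \<and> (\<forall>e\<in>B. L e = y e)"
proof -
  interpret vs: vector_space "\<lambda>(c::real) (f :: 'a \<Rightarrow> real) x. c * f x"
    by unfold_locales (simp_all add: fun_eq_iff distrib_left distrib_right)
  interpret vsp: vector_space_pair "\<lambda>(c::real) (f :: 'a \<Rightarrow> real) x. c * f x" "(*) :: real \<Rightarrow> real \<Rightarrow> real"
    by unfold_locales (simp_all add: distrib_left distrib_right)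
  obtain B where B: "B \<subseteq> E" "vs.independent B" "E \<subseteq> vs.span B"
    using vs.maximal_independent_subset by blast
  have fB: "finite B" using B(1) assms finite_subset by blast
  have ap: "(\<Sum>e\<in>B. (\<lambda>x. u e * e x)) x = (\<Sum>e\<in>B. u e * e x)" for u and x :: 'a
    using fB by (induction B rule: finite_induct) simp_all
  have "\<forall>f\<in>E. \<exists>u. \<forall>x. f x = (\<Sum>e\<in>B. u e * e x)"
  proof
    fix f assume "f \<in> E"
    then have "f \<in> range (\<lambda>u. \<Sum>e\<in>B. (\<lambda>x. u e * e x))"
      using B(3) unfolding vs.span_finite[OF fB] by blast
    then obtain u where "f = (\<Sum>e\<in>B. (\<lambda>x. u e * e x))" by blast
    then show "\<exists>u. \<forall>x. f x = (\<Sum>e\<in>B. u e * e x)" using ap[of u] by (intro exI[of _ u]) simp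
  qed
  from bchoice[OF this] obtain k where k: "\<forall>f\<in>E. \<forall>x. f x = (\<Sum>e\<in>B. k f e * e x)" by blast
  have "\<exists>L. lin L \<and> (\<forall>e\<in>B. L e = y e)" for y
  proof (intro exI conjI ballI)
    let ?L = "vsp.construct B y"
    interpret l: Vector_Spaces.linear "\<lambda>(c::real) (f :: 'a \<Rightarrow> real) x. c * f x" "(*)" ?L
      by (rule vsp.linear_construct[OF B(2)])
    show "lin ?L" unfolding lin_def
    proof (intro conjI allI)
      show "?L (\<lambda>x. f x + g x) = ?L f + ?L g" for f g
        using l.add[of f g] unfolding plus_fun_def .
      show "?L (\<lambda>x. c * f x) = c * ?L f" for c f
        by (rule l.scale)
    qed
    show "?L e = y e" if "e \<in> B" for e by (rule vsp.construct_basis[OF B(2) that])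
  qed
  then show thesis using that[of B k] B(1) k by blast
qed

section \<open>Polynomial functions of bounded degree\<close>

inductive pol :: "nat \<Rightarrow> (real^'n \<Rightarrow> real) \<Rightarrow> bool" where
  pol_const: "pol d (\<lambda>_. c)"
| pol_coord: "1 \<le> d \<Longrightarrow> pol d (\<lambda>x. x $ i)"
| pol_add: "pol d f \<Longrightarrow> pol d g \<Longrightarrow> pol d (\<lambda>x. f x + g x)"
| pol_mult: "pol a f \<Longrightarrow> pol b g \<Longrightarrow> a + b \<le> d \<Longrightarrow> pol d (\<lambda>x. f x * g x)"

lemma pol_scale: "pol d f \<Longrightarrow> pol d (\<lambda>x. c * f x)"
  using pol_mult[OF pol_const[of 0 c], of d f d] by simp

lemma pol_diff: "pol d f \<Longrightarrow> pol d g \<Longrightarrow> pol d (\<lambda>x. f x - g x)"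
  using pol_add[of d f "\<lambda>x. (-1) * g x"] pol_scale[of d g "-1"] by simp

lemma pol_sum: "(\<And>i. i \<in> I \<Longrightarrow> pol d (f i)) \<Longrightarrow> pol d (\<lambda>x. \<Sum>i\<in>I. f i x)"
  by (induction I rule: infinite_finite_induct) (auto intro: pol_const pol_add)

lemma pol_mono: "pol d f \<Longrightarrow> d \<le> d' \<Longrightarrow> pol d' f"
  using pol_mult[OF pol_const[of 0 1], of d f d'] by simp

text \<open>The degree bound is the same for all \<open>a\<close> and \<open>t\<close>; this is what
  allows one relaxation order for all segments.\<close>

lemma pol_affine_line:
  assumes "pol d f" shows "pol d (\<lambda>x. f (a + t *\<^sub>R (x - a)))"
  using assms
proof induction
  case (pol_coord d i)
  have "pol d (\<lambda>x. a $ i + t * (x $ i - a $ i))"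
    using pol_coord by (intro pol_add pol_const pol_scale pol_diff pol.pol_coord)
  then show ?case by simp
next
  case (pol_const d c)
  show ?case by (rule pol.pol_const)
next
  case (pol_add d f g)
  then show ?case by (intro pol.pol_add)
next
  case (pol_mult p f q g d)
  then show ?case by (intro pol.pol_mult[of p _ q])
qed

lemma bounded_linear_vec_expand:
  fixes f :: "real^'n \<Rightarrow> real"
  assumes "bounded_linear f" shows "f x = (\<Sum>i\<in>UNIV. f (axis i 1) * x $ i)"
proof -
  interpret bounded_linear f by (rule assms)
  have "f x = f (\<Sum>i\<in>UNIV. (x $ i) *\<^sub>R axis i 1)"
    by (simp add: basis_expansion flip: scalar_mult_eq_scaleR)
  then show ?thesis
    by (simp add: sum scaleR mult.commute)
qed

lemma real_polynomial_function_imp_pol: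
  fixes f :: "real^'n \<Rightarrow> real"
  assumes "real_polynomial_function f" shows "\<exists>d. pol d f"
  using assms
proof induction
  case (linear f)
  have "f = (\<lambda>x. \<Sum>i\<in>UNIV. f (axis i 1) * x $ i)"
    using bounded_linear_vec_expand[OF linear] by blast
  moreover have "pol 1 (\<lambda>x. \<Sum>i\<in>UNIV. f (axis i 1) * x $ i)"
    by (intro pol_sum pol_scale pol_coord) simp
  ultimately show ?case by (intro exI[of _ 1]) simp
next
  case (add f g)
  then obtain a b where "pol a f" "pol b g" by blast
  then have "pol (max a b) f" "pol (max a b) g" by (simp_all add: pol_mono)
  then show ?case using pol_add by blast
next
  case (mult f g)
  then obtain a b where "pol a f" "pol b g" by blast
  then show ?case using pol_mult[OF _ _ order_refl] by blast
next
  case (const c)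
  show ?case using pol_const by blast
qed

lemma pol_imp_real_polynomial_function: "pol d f \<Longrightarrow> real_polynomial_function f"
proof (induction rule: pol.induct)
  case (pol_coord d i)
  show ?case by (rule real_polynomial_function.intros(1)) (rule bounded_linear_vec_nth)
qed (rule real_polynomial_function.intros; assumption)+

section \<open>Monomial expansions and localizing matrices\<close>

definition mon :: "('n \<Rightarrow> nat) \<Rightarrow> real^'n \<Rightarrow> real" where
  "mon \<alpha> x = (\<Prod>i\<in>UNIV. x $ i ^ \<alpha> i)"

definition exps :: "nat \<Rightarrow> ('n::finite \<Rightarrow> nat) set" where
  "exps d = {\<alpha>. (\<Sum>i\<in>UNIV. \<alpha> i) \<le> d}"

lemma finite_exps: "finite (exps d :: ('n::finite \<Rightarrow> nat) set)"
proof (rule finite_subset)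
  show "exps d \<subseteq> (PiE UNIV (\<lambda>_. {..d}) :: ('n \<Rightarrow> nat) set)"
  proof
    fix \<alpha> :: "'n \<Rightarrow> nat" assume "\<alpha> \<in> exps d"
    then have "\<alpha> i \<le> d" for i
      using member_le_sum[of i UNIV \<alpha>] by (auto simp: exps_def)
    then show "\<alpha> \<in> PiE UNIV (\<lambda>_. {..d})" by auto
  qed
qed (auto intro: finite_PiE)

lemma mon_mult: "mon \<alpha> x * mon \<beta> x = mon (\<lambda>i. \<alpha> i + \<beta> i) x"
  by (simp add: mon_def power_add prod.distrib)

lemma pol_mon: "\<alpha> \<in> exps d \<Longrightarrow> pol d (mon \<alpha>)"
proof -
  have pw: "pol k (\<lambda>x. x $ i ^ k)" for k i
  proof (induction k)
    case (Suc k)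
    show ?case using pol_mult[OF pol_coord[of 1 i] Suc, of "Suc k"] by simp
  qed (simp add: pol_const)
  have "pol (\<Sum>i\<in>I. \<alpha> i) (\<lambda>x. \<Prod>i\<in>I. x $ i ^ \<alpha> i)" for I
  proof (induction I rule: infinite_finite_induct)
    case (insert i I)
    then show ?case using pol_mult[OF pw insert(3) order_refl] by simp
  qed (simp_all add: pol_const)
  then show "\<alpha> \<in> exps d \<Longrightarrow> pol d (mon \<alpha>)"
    unfolding mon_def[abs_def] exps_def by (auto intro: pol_mono)
qed

definition mon_span :: "nat \<Rightarrow> (real^'n \<Rightarrow> real) set" where
  "mon_span d = {f. \<exists>c. f = (\<lambda>x. \<Sum>\<alpha>\<in>exps d. c \<alpha> * mon \<alpha> x)}"

lemma mon_span_mon: "\<alpha> \<in> exps d \<Longrightarrow> mon \<alpha> \<in> mon_span d"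
  unfolding mon_span_def
  by (auto intro!: exI[of _ "\<lambda>\<beta>. if \<beta> = \<alpha> then 1 else 0"] simp: finite_exps if_distrib[of "\<lambda>c. c * _"] cong: if_cong)

lemma mon_span_add: "f \<in> mon_span d \<Longrightarrow> g \<in> mon_span d \<Longrightarrow> (\<lambda>x. f x + g x) \<in> mon_span d"
proof -
  assume "f \<in> mon_span d" "g \<in> mon_span d"
  then obtain c c' where "f = (\<lambda>x. \<Sum>\<alpha>\<in>exps d. c \<alpha> * mon \<alpha> x)" "g = (\<lambda>x. \<Sum>\<alpha>\<in>exps d. c' \<alpha> * mon \<alpha> x)"
    unfolding mon_span_def by blast
  then show ?thesis unfolding mon_span_def
    by (auto intro!: exI[of _ "\<lambda>\<alpha>. c \<alpha> + c' \<alpha>"] simp: sum.distrib distrib_right)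
qed

lemma mon_span_scale: "f \<in> mon_span d \<Longrightarrow> (\<lambda>x. k * f x) \<in> mon_span d"
proof -
  assume "f \<in> mon_span d"
  then obtain c where "f = (\<lambda>x. \<Sum>\<alpha>\<in>exps d. c \<alpha> * mon \<alpha> x)"
    unfolding mon_span_def by blast
  then show ?thesis unfolding mon_span_def
    by (auto intro!: exI[of _ "\<lambda>\<alpha>. k * c \<alpha>"] simp: sum_distrib_left mult.assoc)
qed

lemma mon_span_sum: "(\<And>i. i \<in> I \<Longrightarrow> f i \<in> mon_span d) \<Longrightarrow> (\<lambda>x. \<Sum>i\<in>I. f i x) \<in> mon_span d"
proof (induction I rule: infinite_finite_induct)
  case empty
  show ?case unfolding mon_span_def by (auto intro!: exI[of _ "\<lambda>_. 0"])
next
  case (infinite I)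
  then show ?case unfolding mon_span_def by (auto intro!: exI[of _ "\<lambda>_. 0"])
qed (auto intro: mon_span_add)

lemma pol_imp_mon_span: "pol d f \<Longrightarrow> f \<in> mon_span d"
proof (induction rule: pol.induct)
  case (pol_const d c)
  have "(\<lambda>x. c * mon (\<lambda>_. 0) x) \<in> mon_span d"
    by (intro mon_span_scale mon_span_mon) (simp add: exps_def)
  then show ?case by (simp add: mon_def)
next
  case (pol_coord d i)
  have "mon (\<lambda>j. if j = i then 1 else 0) = (\<lambda>x. x $ i)"
    by (auto simp: mon_def fun_eq_iff if_distrib cong: if_cong)
  then show ?case using pol_coord mon_span_mon[of "\<lambda>j. if j = i then 1 else 0" d] by (simp add: exps_def)
next
  case (pol_add d f g)
  then show ?case by (simp add: mon_span_add)
next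
  case (pol_mult a f b g d)
  then obtain c c' where f: "f = (\<lambda>x. \<Sum>\<alpha>\<in>exps a. c \<alpha> * mon \<alpha> x)" and g: "g = (\<lambda>x. \<Sum>\<beta>\<in>exps b. c' \<beta> * mon \<beta> x)"
    unfolding mon_span_def by blast
  have "(\<lambda>x. \<Sum>\<alpha>\<in>exps a. \<Sum>\<beta>\<in>exps b. (c \<alpha> * c' \<beta>) * mon (\<lambda>i. \<alpha> i + \<beta> i) x) \<in> mon_span d"
    using pol_mult(3) by (intro mon_span_sum mon_span_scale mon_span_mon) (auto simp: exps_def sum.distrib)
  moreover have "(\<lambda>x. f x * g x) = (\<lambda>x. \<Sum>\<alpha>\<in>exps a. \<Sum>\<beta>\<in>exps b. (c \<alpha> * c' \<beta>) * mon (\<lambda>i. \<alpha> i + \<beta> i) x)"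
    unfolding f g sum_product mon_mult[symmetric] by (intro ext sum.cong refl) simp
  ultimately show ?case by simp
qed

text \<open>Positive semidefiniteness of the localizing matrix of order \<open>d\<close> with weight \<open>w\<close>
  in the moment relaxation.\<close>

definition loc_nonneg :: "((real^'n \<Rightarrow> real) \<Rightarrow> real) \<Rightarrow> nat \<Rightarrow> (real^'n \<Rightarrow> real) \<Rightarrow> bool" where
  "loc_nonneg L d w \<longleftrightarrow> (\<forall>p. pol d p \<longrightarrow> 0 \<le> L (\<lambda>x. w x * (p x)\<^sup>2))"

text \<open>Expanding the square of a combination of monomials gives the quadratic form of the
  localizing matrix, and by \<open>pol_imp_mon_span\<close> these combinations exhaust the
  polynomials tested. The entries are linear in \<open>L\<close>, as a linear matrix inequality
  requires.\<close>

lemma loc_nonneg_iff: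
  fixes L :: "(real^'n \<Rightarrow> real) \<Rightarrow> real"
  assumes "lin L"
  shows "loc_nonneg L d w \<longleftrightarrow>
    (\<forall>z. 0 \<le> (\<Sum>\<alpha>\<in>exps d. \<Sum>\<beta>\<in>exps d. z \<alpha> * L (\<lambda>x. w x * mon \<alpha> x * mon \<beta> x) * z \<beta>))"
proof -
  have eq: "L (\<lambda>x. w x * (\<Sum>\<alpha>\<in>exps d. z \<alpha> * mon \<alpha> x)\<^sup>2) =
      (\<Sum>\<alpha>\<in>exps d. \<Sum>\<beta>\<in>exps d. z \<alpha> * L (\<lambda>x. w x * mon \<alpha> x * mon \<beta> x) * z \<beta>)" for z
  proof -
    have "(\<lambda>x. w x * (\<Sum>\<alpha>\<in>exps d. z \<alpha> * mon \<alpha> x)\<^sup>2) =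
       (\<lambda>x. \<Sum>\<alpha>\<in>exps d. \<Sum>\<beta>\<in>exps d. (z \<alpha> * z \<beta>) * (w x * mon \<alpha> x * mon \<beta> x))"
      by (simp add: power2_eq_square sum_product sum_distrib_left mult_ac)
    then show ?thesis
      by (simp only: lin_sum[OF assms] lin_scale[OF assms]) (intro sum.cong refl, simp)
  qed
  show ?thesis
  proof
    assume L: "loc_nonneg L d w"
    show "\<forall>z. 0 \<le> (\<Sum>\<alpha>\<in>exps d. \<Sum>\<beta>\<in>exps d. z \<alpha> * L (\<lambda>x. w x * mon \<alpha> x * mon \<beta> x) * z \<beta>)"
    proof
      fix z :: "('n \<Rightarrow> nat) \<Rightarrow> real"
      have "pol d (\<lambda>x. \<Sum>\<alpha>\<in>exps d. z \<alpha> * mon \<alpha> x)"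
        by (intro pol_sum pol_scale pol_mon)
      then show "0 \<le> (\<Sum>\<alpha>\<in>exps d. \<Sum>\<beta>\<in>exps d. z \<alpha> * L (\<lambda>x. w x * mon \<alpha> x * mon \<beta> x) * z \<beta>)"
        using L unfolding loc_nonneg_def eq[symmetric] by blast
    qed
  next
    assume R: "\<forall>z. 0 \<le> (\<Sum>\<alpha>\<in>exps d. \<Sum>\<beta>\<in>exps d. z \<alpha> * L (\<lambda>x. w x * mon \<alpha> x * mon \<beta> x) * z \<beta>)"
    show "loc_nonneg L d w" unfolding loc_nonneg_def
    proof (intro allI impI)
      fix p :: "real^'n \<Rightarrow> real" assume "pol d p"
      then obtain z where "p = (\<lambda>x. \<Sum>\<alpha>\<in>exps d. z \<alpha> * mon \<alpha> x)"
        using pol_imp_mon_span unfolding mon_span_def by blast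
      then show "0 \<le> L (\<lambda>x. w x * (p x)\<^sup>2)" using R eq[of z] by simp
    qed
  qed
qed

text \<open>A pair consists of an order and a weight: \<open>(d, \<lambda>_. 1)\<close> is the
  condition on the moment matrix of order \<open>d\<close>, while \<open>(0, w)\<close> only says
  that \<open>L w\<close> is nonnegative.\<close>

definition sat :: "((real^'n \<Rightarrow> real) \<Rightarrow> real) \<Rightarrow> (nat \<times> (real^'n \<Rightarrow> real)) set \<Rightarrow> bool" where
  "sat L C \<longleftrightarrow> (\<forall>(d, w)\<in>C. loc_nonneg L d w)"

text \<open>Only the total mass of the functionals is normalised: this homogenization is what produces
  convex hulls of unions.\<close>

definition moment_hull :: "'j set \<Rightarrow> ('j \<Rightarrow> (nat \<times> (real^'n \<Rightarrow> real)) set) \<Rightarrow> (real^'n) set" where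
  "moment_hull J C = {x. \<exists>L. (\<forall>j\<in>J. lin (L j) \<and> sat (L j) (C j)) \<and>
      (\<Sum>j\<in>J. L j (\<lambda>_. 1)) = 1 \<and> (\<forall>i. (\<Sum>j\<in>J. L j (\<lambda>x. x $ i)) = x $ i)}"

lemma sdp_representable_moment_hull:
  fixes C :: "'j \<Rightarrow> (nat \<times> (real^'n \<Rightarrow> real)) set"
  assumes J: "finite J" and C: "\<And>j. j \<in> J \<Longrightarrow> finite (C j)"
  shows "sdp_representable (moment_hull J C)"
proof -
  \<comment> \<open>All functions at which the defining conditions evaluate a functional: total
    mass, first moments and entries of the localizing matrices. One basis is used for all
    \<open>j\<close>.\<close>
  define E where "E = {\<lambda>_::real^'n. 1::real} \<union> range (\<lambda>i x. x $ i) \<union>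
    (\<Union>j\<in>J. \<Union>(d, w)\<in>C j. (\<lambda>(\<alpha>, \<beta>) x. w x * mon \<alpha> x * mon \<beta> x) ` (exps d \<times> exps d))"
  have "finite E" unfolding E_def using J C by (auto simp: finite_exps)
  then obtain B k where B: "B \<subseteq> E" and k: "\<And>f x. f \<in> E \<Longrightarrow> f x = (\<Sum>e\<in>B. k f e * e x)"
    and ext: "\<And>y. \<exists>L. lin L \<and> (\<forall>e\<in>B. L e = y e)"
    by (rule basis_of_finite_functions) blast
  have fB: "finite B" using B \<open>finite E\<close> finite_subset by blast
  have Lk: "L f = (\<Sum>e\<in>B. k f e * L e)" if "lin L" "f \<in> E" for L f
  proof -
    have "f = (\<lambda>x. \<Sum>e\<in>B. k f e * e x)" using k[OF that(2)] by blast
    then have "L f = L (\<lambda>x. \<Sum>e\<in>B. k f e * e x)" by simp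
    then show ?thesis by (simp add: lin_sum[OF that(1)] lin_scale[OF that(1)])
  qed
  have E1: "(\<lambda>_. 1) \<in> E" and Ei: "(\<lambda>x. x $ i) \<in> E" for i by (auto simp: E_def)
  have Em: "(\<lambda>x. w x * mon \<alpha> x * mon \<beta> x) \<in> E"
    if "j \<in> J" "(d, w) \<in> C j" "\<alpha> \<in> exps d" "\<beta> \<in> exps d" for j d w \<alpha> \<beta>
    unfolding E_def using that by (intro UnI2 UN_I[of j] UN_I[of "(d, w)"]) auto
  \<comment> \<open>The value of \<open>L j\<close> at \<open>f\<close>, written as a linear form in
    the lifting variables; \<open>u (j, e)\<close> stands for the value of \<open>L j\<close> at the
    basis function \<open>e\<close>.\<close>
  define l where "l j f u = (\<Sum>e\<in>B. k f e * u (j, e))" for j f and u :: "'j \<times> (real^'n \<Rightarrow> real) \<Rightarrow> real"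
  define P where "P x u \<longleftrightarrow> (\<forall>j\<in>J. \<forall>c\<in>C j. \<forall>z. 0 \<le> (\<Sum>\<alpha>\<in>exps (fst c). \<Sum>\<beta>\<in>exps (fst c).
        z \<alpha> * l j (\<lambda>x. snd c x * mon \<alpha> x * mon \<beta> x) u * z \<beta>)) \<and>
      (\<Sum>j\<in>J. l j (\<lambda>_. 1) u) = 1 \<and> (\<forall>i\<in>UNIV. (\<Sum>j\<in>J. l j (\<lambda>x. x $ i) u) = x $ i)"
    for x :: "real^'n" and u
  have aff_l: "aff (J \<times> B) (\<lambda>x u. l j f u)" if "j \<in> J" for j f
    unfolding l_def using J fB that by (intro aff_sum aff_scale aff_var) auto
  have "lmi (J \<times> B) P"
    unfolding P_def[abs_def]
  proof (intro lmi_conj lmi_Ball lmi_eq J C lmi_psd)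
    show "(\<lambda>x u. l j (\<lambda>x. snd c x * mon \<alpha> x * mon \<beta> x) u) = (\<lambda>x u. l j (\<lambda>x. snd c x * mon \<beta> x * mon \<alpha> x) u)"
      for j c \<alpha> \<beta> by (simp add: mult_ac)
  qed (auto intro!: finite_exps aff_l aff_sum J aff_const aff_coord)
  then have "sdp_representable {x. \<exists>u. P x u}"
    using J fB by (intro lmi_imp_sdp_representable[of "J \<times> B"]) auto
  moreover have "(\<exists>u. P x u) \<longleftrightarrow> x \<in> moment_hull J C" for x
  proof -
    have key: "P x u \<longleftrightarrow> (\<forall>j\<in>J. sat (L j) (C j)) \<and>
      (\<Sum>j\<in>J. L j (\<lambda>_. 1)) = 1 \<and> (\<forall>i. (\<Sum>j\<in>J. L j (\<lambda>x. x $ i)) = x $ i)"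
      if lin: "\<And>j. j \<in> J \<Longrightarrow> lin (L j)" and eq: "\<And>j e. j \<in> J \<Longrightarrow> e \<in> B \<Longrightarrow> L j e = u (j, e)" for L u
    proof -
      have lL: "l j f u = L j f" if "j \<in> J" "f \<in> E" for j f
        unfolding l_def using Lk[OF lin[OF that(1)] that(2)] eq[OF that(1)] by simp
      have "(\<forall>z. 0 \<le> (\<Sum>\<alpha>\<in>exps (fst c). \<Sum>\<beta>\<in>exps (fst c).
          z \<alpha> * l j (\<lambda>x. snd c x * mon \<alpha> x * mon \<beta> x) u * z \<beta>)) \<longleftrightarrow> loc_nonneg (L j) (fst c) (snd c)"
        if "j \<in> J" "c \<in> C j" for j c
      proof -
        have "(\<Sum>\<alpha>\<in>exps (fst c). \<Sum>\<beta>\<in>exps (fst c). z \<alpha> * l j (\<lambda>x. snd c x * mon \<alpha> x * mon \<beta> x) u * z \<beta>) =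
          (\<Sum>\<alpha>\<in>exps (fst c). \<Sum>\<beta>\<in>exps (fst c). z \<alpha> * L j (\<lambda>x. snd c x * mon \<alpha> x * mon \<beta> x) * z \<beta>)" for z
          using that by (intro sum.cong refl) (simp add: lL Em[of j "fst c"])
        then show ?thesis unfolding loc_nonneg_iff[OF lin[OF that(1)]] by simp
      qed
      then show ?thesis unfolding P_def sat_def
        by (simp add: lL E1 Ei case_prod_beta cong: sum.cong)
    qed
    show ?thesis
    proof
      assume "\<exists>u. P x u"
      then obtain u where u: "P x u" by blast
      have "\<forall>j. \<exists>L. lin L \<and> (\<forall>e\<in>B. L e = u (j, e))"
        using ext[of "\<lambda>e. u (_, e)"] by simp
      then obtain L where "\<And>j. lin (L j)" "\<And>j e. e \<in> B \<Longrightarrow> L j e = u (j, e)" by metis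
      then show "x \<in> moment_hull J C" using key[of L u] u unfolding moment_hull_def by blast
    next
      assume "x \<in> moment_hull J C"
      then obtain L where L: "\<forall>j\<in>J. lin (L j) \<and> sat (L j) (C j)"
        "(\<Sum>j\<in>J. L j (\<lambda>_. 1)) = 1" "\<forall>i. (\<Sum>j\<in>J. L j (\<lambda>x. x $ i)) = x $ i"
        unfolding moment_hull_def by blast
      then have "P x (\<lambda>(j, e). L j e)" by (subst key[of L]) auto
      then show "\<exists>u. P x u" by blast
    qed
  qed
  ultimately show ?thesis by simp
qed

section \<open>Partial derivatives of polynomials and Jensen's inequality\<close>

definition has_partials :: "(real^'n \<Rightarrow> real) \<Rightarrow> ('n \<Rightarrow> real^'n \<Rightarrow> real) \<Rightarrow> bool" where
  "has_partials f q \<longleftrightarrow> (\<forall>x. (f has_derivative (\<lambda>v. \<Sum>i\<in>UNIV. q i x * v $ i)) (at x))"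

lemma has_partials_const: "has_partials (\<lambda>_. c) (\<lambda>i x. 0)"
  by (simp add: has_partials_def)

lemma has_partials_add:
  assumes "has_partials f p" "has_partials g q"
  shows "has_partials (\<lambda>x. f x + g x) (\<lambda>i x. p i x + q i x)"
  unfolding has_partials_def
proof
  fix x
  have "((\<lambda>x. f x + g x) has_derivative (\<lambda>v. (\<Sum>i\<in>UNIV. p i x * v $ i) + (\<Sum>i\<in>UNIV. q i x * v $ i))) (at x)"
    using assms by (intro has_derivative_add) (auto simp: has_partials_def)
  then show "((\<lambda>x. f x + g x) has_derivative (\<lambda>v. \<Sum>i\<in>UNIV. (p i x + q i x) * v $ i)) (at x)"
    by (simp add: distrib_right sum.distrib)
qed

lemma has_partials_mult:
  assumes "has_partials f p" "has_partials g q"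
  shows "has_partials (\<lambda>x. f x * g x) (\<lambda>i x. f x * q i x + p i x * g x)"
  unfolding has_partials_def
proof
  fix x
  have "((\<lambda>x. f x * g x) has_derivative (\<lambda>v. f x * (\<Sum>i\<in>UNIV. q i x * v $ i) + (\<Sum>i\<in>UNIV. p i x * v $ i) * g x)) (at x)"
    using assms by (intro has_derivative_mult) (auto simp: has_partials_def)
  then show "((\<lambda>x. f x * g x) has_derivative (\<lambda>v. \<Sum>i\<in>UNIV. (f x * q i x + p i x * g x) * v $ i)) (at x)"
    by (simp add: algebra_simps sum.distrib sum_distrib_left)
qed

text \<open>The partial derivatives are delivered as polynomial functions again, so a second
  application yields the entries of the Hessian.\<close>

lemma real_polynomial_function_partials:
  fixes f :: "real^'n \<Rightarrow> real"
  assumes "real_polynomial_function f"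
  shows "\<exists>q. (\<forall>i. real_polynomial_function (q i)) \<and> has_partials f q"
  using assms
proof induction
  case (linear f)
  then have "has_partials f (\<lambda>i x. f (axis i 1))"
    unfolding has_partials_def bounded_linear_vec_expand[OF linear, symmetric]
    by (intro allI bounded_linear_imp_has_derivative)
  then show ?case by (intro exI[of _ "\<lambda>i x. f (axis i 1)"] conjI allI real_polynomial_function.intros(2))
next
  case (const c)
  show ?case
    by (intro exI[of _ "\<lambda>i x. 0"] conjI allI real_polynomial_function.intros(2) has_partials_const)
next
  case (add f g)
  then obtain p q where "\<forall>i. real_polynomial_function (p i)" "has_partials f p"
    "\<forall>i. real_polynomial_function (q i)" "has_partials g q" by blast
  then show ?case
    by (intro exI[of _ "\<lambda>i x. p i x + q i x"] conjI allI has_partials_add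
         real_polynomial_function.intros(3)) simp_all
next
  case (mult f g)
  then obtain p q where "\<forall>i. real_polynomial_function (p i)" "has_partials f p"
    "\<forall>i. real_polynomial_function (q i)" "has_partials g q" by blast
  then show ?case using mult.hyps
    by (intro exI[of _ "\<lambda>i x. f x * q i x + p i x * g x"] conjI allI has_partials_mult
         real_polynomial_function.intros(3) real_polynomial_function.intros(4)) simp_all
qed

lemma has_partials_grad:
  assumes "has_partials f q" shows "grad f x $ i = q i x"
proof -
  have "frechet_derivative f (at x) = (\<lambda>v. \<Sum>i\<in>UNIV. q i x * v $ i)"
    using assms unfolding has_partials_def by (intro frechet_derivative_at[symmetric]) blast
  then show ?thesis by (simp add: grad_def axis_def if_distrib cong: if_cong)
qed

lemma has_partials_hessian:
  assumes f: "has_partials f q" and q: "\<And>i. has_partials (q i) (qq i)"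
  shows "hessian f x $ i $ j = qq i j x"
proof -
  have "(grad f has_derivative (\<lambda>v. \<chi> i. \<Sum>j\<in>UNIV. qq i j x * v $ j)) (at x)"
    unfolding has_derivative_componentwise_within[of "grad f"] Basis_vec_def
    using q by (auto simp: inner_axis has_partials_grad[OF f] has_partials_def)
  then have "frechet_derivative (grad f) (at x) = (\<lambda>v. \<chi> i. \<Sum>j\<in>UNIV. qq i j x * v $ j)"
    by (rule frechet_derivative_at[symmetric])
  then show ?thesis by (simp add: hessian_def jacobian_def matrix_def axis_def if_distrib cong: if_cong)
qed

text \<open>What matters is that the bound on the degree in \<open>t\<close> does not depend on
  \<open>x\<close>.\<close>

lemma pol_line_poly:
  assumes "pol d f"
  shows "\<exists>P. \<forall>x. degree (P x) \<le> d \<and> (\<forall>t. f (a + t *\<^sub>R (x - a)) = poly (P x) t)"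
  using assms
proof induction
  case (pol_const d c)
  show ?case by (rule exI[of _ "\<lambda>x. [:c:]"]) simp
next
  case (pol_coord d i)
  then show ?case by (intro exI[of _ "\<lambda>x. [:a $ i, x $ i - a $ i:]"]) simp
next
  case (pol_add d f g)
  then obtain P Q where "\<And>x. degree (P x) \<le> d" "\<And>x t. f (a + t *\<^sub>R (x - a)) = poly (P x) t"
     "\<And>x. degree (Q x) \<le> d" "\<And>x t. g (a + t *\<^sub>R (x - a)) = poly (Q x) t" by metis
  then show ?case by (intro exI[of _ "\<lambda>x. P x + Q x"]) (simp add: degree_add_le)
next
  case (pol_mult b f c g d)
  then obtain P Q where *: "\<And>x. degree (P x) \<le> b" "\<And>x t. f (a + t *\<^sub>R (x - a)) = poly (P x) t"
     "\<And>x. degree (Q x) \<le> c" "\<And>x t. g (a + t *\<^sub>R (x - a)) = poly (Q x) t" by metis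
  have "degree (P x * Q x) \<le> d" for x
    using degree_mult_le[of "P x" "Q x"] *(1)[of x] *(3)[of x] pol_mult(3) by linarith
  with * show ?case by (intro exI[of _ "\<lambda>x. P x * Q x"]) simp
qed

text \<open>Since the degrees in \<open>t\<close> are bounded by \<open>K\<close>, the function
  under \<open>L\<close> is a fixed finite combination of powers of \<open>t\<close> with
  coefficients depending on \<open>x\<close>. Hence linearity alone, without continuity of
  \<open>L\<close>, permits differentiation under \<open>L\<close>.\<close>

lemma lin_poly_has_field_derivative:
  fixes P :: "'a \<Rightarrow> real poly"
  assumes L: "lin L" and deg: "\<And>x. degree (P x) \<le> K"
  shows "((\<lambda>t. L (\<lambda>x. poly (P x) t)) has_field_derivative L (\<lambda>x. poly (pderiv (P x)) t)) (at t)"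
proof -
  have ex: "poly (P x) t = (\<Sum>k\<le>K. t ^ k * coeff (P x) k)" for x t
  proof -
    have "poly (P x) t = (\<Sum>k\<le>degree (P x). t ^ k * coeff (P x) k)"
      by (simp add: poly_altdef mult.commute)
    also have "\<dots> = (\<Sum>k\<le>K. t ^ k * coeff (P x) k)"
      using deg by (intro sum.mono_neutral_left) (auto simp: coeff_eq_0)
    finally show ?thesis .
  qed
  have ex': "poly (pderiv (P x)) t = (\<Sum>k\<le>K. (real k * t ^ (k - 1)) * coeff (P x) k)" for x
  proof (rule DERIV_unique)
    show "((\<lambda>t. poly (P x) t) has_field_derivative poly (pderiv (P x)) t) (at t)" by (rule poly_DERIV)
    show "((\<lambda>t. poly (P x) t) has_field_derivative (\<Sum>k\<le>K. (real k * t ^ (k - 1)) * coeff (P x) k)) (at t)"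
      unfolding ex using DERIV_pow by (intro DERIV_sum DERIV_cmult_right) simp
  qed
  show ?thesis
    unfolding ex ex' lin_sum[OF L] lin_scale[OF L] using DERIV_pow
    by (intro DERIV_sum DERIV_cmult_right) simp
qed

lemma has_partials_line:
  assumes "has_partials f q"
  shows "((\<lambda>t. f (a + t *\<^sub>R (x - a))) has_field_derivative
           (\<Sum>i\<in>UNIV. q i (a + t *\<^sub>R (x - a)) * (x $ i - a $ i))) (at t)"
proof -
  have "((\<lambda>t. a + t *\<^sub>R (x - a)) has_derivative (\<lambda>s. s *\<^sub>R (x - a))) (at t)"
    by (auto intro!: derivative_eq_intros)
  from has_derivative_compose[OF this, of f] assms
  have "((\<lambda>t. f (a + t *\<^sub>R (x - a))) has_derivative
      (\<lambda>s. \<Sum>i\<in>UNIV. q i (a + t *\<^sub>R (x - a)) * (s *\<^sub>R (x - a)) $ i)) (at t)"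
    unfolding has_partials_def by blast
  moreover have "(\<lambda>s. \<Sum>i\<in>UNIV. q i (a + t *\<^sub>R (x - a)) * (s *\<^sub>R (x - a)) $ i) =
      (*) (\<Sum>i\<in>UNIV. q i (a + t *\<^sub>R (x - a)) * (x $ i - a $ i))"
    by (simp add: fun_eq_iff sum_distrib_left mult_ac)
  ultimately show ?thesis by (simp only: has_field_derivative_def)
qed

text \<open>The function \<open>t \<mapsto> L (h (a + t (x - a)))\<close> is concave on \<open>[0, 1]\<close>, and its derivative at
  \<open>0\<close> vanishes because \<open>a\<close> is the barycentre.\<close>

lemma lin_jensen:
  assumes L: "lin L" and L1: "L (\<lambda>_. 1) = 1" and La: "\<And>i. L (\<lambda>x. x $ i) = a $ i"
    and h: "pol d h" and q: "has_partials h q" and qq: "\<And>i. has_partials (q i) (qq i)"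
    and neg: "\<And>t. 0 \<le> t \<Longrightarrow> t \<le> 1 \<Longrightarrow> L (\<lambda>x. \<Sum>i\<in>UNIV. \<Sum>j\<in>UNIV.
        qq i j (a + t *\<^sub>R (x - a)) * ((x $ i - a $ i) * (x $ j - a $ j))) \<le> 0"
  shows "L h \<le> h a"
proof -
  have Lc: "L (\<lambda>_. c) = c" for c using lin_scale[OF L, of c "\<lambda>_. 1"] L1 by simp
  obtain P where deg: "\<And>x. degree (P x) \<le> d" and P: "\<And>x t. h (a + t *\<^sub>R (x - a)) = poly (P x) t"
    using pol_line_poly[OF h, of a] by metis
  have P1: "poly (pderiv (P x)) t = (\<Sum>i\<in>UNIV. q i (a + t *\<^sub>R (x - a)) * (x $ i - a $ i))" for x t
    using DERIV_unique[OF poly_DERIV has_partials_line[OF q, of a x t, unfolded P]] .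
  have P2: "poly (pderiv (pderiv (P x))) t = (\<Sum>i\<in>UNIV. \<Sum>j\<in>UNIV.
        qq i j (a + t *\<^sub>R (x - a)) * ((x $ i - a $ i) * (x $ j - a $ j)))" for x t
  proof (rule DERIV_unique)
    show "(poly (pderiv (P x)) has_field_derivative poly (pderiv (pderiv (P x))) t) (at t)"
      by (rule poly_DERIV)
    have "((\<lambda>t. \<Sum>i\<in>UNIV. q i (a + t *\<^sub>R (x - a)) * (x $ i - a $ i)) has_field_derivative
        (\<Sum>i\<in>UNIV. (\<Sum>j\<in>UNIV. qq i j (a + t *\<^sub>R (x - a)) * (x $ j - a $ j)) * (x $ i - a $ i))) (at t)"
      by (intro DERIV_sum DERIV_cmult_right has_partials_line qq)
    then show "(poly (pderiv (P x)) has_field_derivative (\<Sum>i\<in>UNIV. \<Sum>j\<in>UNIV.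
        qq i j (a + t *\<^sub>R (x - a)) * ((x $ i - a $ i) * (x $ j - a $ j)))) (at t)"
      unfolding P1[abs_def] by (simp add: sum_distrib_left mult_ac)
  qed
  define \<phi> where "\<phi> t = L (\<lambda>x. poly (P x) t)" for t
  define \<phi>1 where "\<phi>1 t = L (\<lambda>x. poly (pderiv (P x)) t)" for t
  define \<phi>2 where "\<phi>2 t = L (\<lambda>x. poly (pderiv (pderiv (P x))) t)" for t
  have d1: "(\<phi> has_field_derivative \<phi>1 t) (at t)" for t
    unfolding \<phi>_def[abs_def] \<phi>1_def by (rule lin_poly_has_field_derivative[OF L deg])
  have d2: "(\<phi>1 has_field_derivative \<phi>2 t) (at t)" for t
    unfolding \<phi>1_def[abs_def] \<phi>2_def
    by (rule lin_poly_has_field_derivative[OF L, of _ d]) (use deg in \<open>simp add: degree_pderiv le_diff_conv le_SucI\<close>)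
  have neg2: "\<phi>2 t \<le> 0" if "0 \<le> t" "t \<le> 1" for t
    unfolding \<phi>2_def P2 using neg[OF that] .
  have "\<phi>1 0 = 0"
    unfolding \<phi>1_def P1 by (simp add: lin_sum[OF L] lin_scale[OF L] lin_diff[OF L] La Lc)
  then have neg1: "\<phi>1 t \<le> 0" if "0 \<le> t" "t \<le> 1" for t
    using DERIV_nonpos_imp_nonincreasing[of 0 t \<phi>1] that d2 neg2
    by (metis order_trans)
  have "\<phi> 1 \<le> \<phi> 0"
    by (rule DERIV_nonpos_imp_nonincreasing[of 0 1 \<phi>]) (use d1 neg1 in auto)
  moreover have "\<phi> 1 = L h" "\<phi> 0 = h a"
    unfolding \<phi>_def P[symmetric] by (simp_all add: Lc)
  ultimately show ?thesis by simp
qed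

section \<open>Bounds on small balls\<close>

lemma loc_nonnegD: "loc_nonneg L d w \<Longrightarrow> pol d p \<Longrightarrow> 0 \<le> L (\<lambda>x. w x * (p x)\<^sup>2)"
  unfolding loc_nonneg_def by blast

lemma loc_nonneg_mono: "loc_nonneg L d w \<Longrightarrow> k \<le> d \<Longrightarrow> loc_nonneg L k w"
  unfolding loc_nonneg_def using pol_mono by blast

lemma loc_nonneg_functional: "loc_nonneg L d w \<Longrightarrow> 0 \<le> L w"
  using loc_nonnegD[of L d w "\<lambda>_. 1"] pol_const[of d 1] by simp

text \<open>A square factor is absorbed into the test polynomial,
  \<open>q^2 w p^2 = w (p q)^2\<close>, at the cost of \<open>e\<close> in the order.\<close>

lemma loc_nonneg_square_mult:
  fixes L :: "(real^'n \<Rightarrow> real) \<Rightarrow> real"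
  assumes "loc_nonneg L d w" "pol e q" "k + e \<le> d"
  shows "loc_nonneg L k (\<lambda>x. (q x)\<^sup>2 * w x)"
  unfolding loc_nonneg_def
proof (intro allI impI)
  fix p :: "real^'n \<Rightarrow> real" assume "pol k p"
  then have "pol d (\<lambda>x. p x * q x)" using assms(2,3) by (rule pol_mult)
  from loc_nonnegD[OF assms(1) this] show "0 \<le> L (\<lambda>x. (q x)\<^sup>2 * w x * (p x)\<^sup>2)"
    by (simp add: power_mult_distrib mult_ac)
qed

lemma loc_nonneg_square:
  assumes "loc_nonneg L d (\<lambda>_. 1)" "pol e q" "k + e \<le> d"
  shows "loc_nonneg L k (\<lambda>x. (q x)\<^sup>2)"
  using loc_nonneg_square_mult[OF assms] by simp

lemma loc_nonneg_add:
  assumes "lin L" "loc_nonneg L d v" "loc_nonneg L d w"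
  shows "loc_nonneg L d (\<lambda>x. v x + w x)"
  using assms(2,3) unfolding loc_nonneg_def
  by (simp add: distrib_right lin_add[OF assms(1)])

lemma loc_nonneg_scale:
  assumes "lin L" "loc_nonneg L d w" "0 \<le> c"
  shows "loc_nonneg L d (\<lambda>x. c * w x)"
  using assms(2,3) unfolding loc_nonneg_def
  by (simp add: mult.assoc lin_scale[OF assms(1)])

lemma loc_nonneg_const:
  assumes "lin L" "loc_nonneg L d (\<lambda>_. 1)" "0 \<le> c"
  shows "loc_nonneg L d (\<lambda>_. c)"
  using loc_nonneg_scale[OF assms] by simp

lemma loc_nonneg_sum:
  assumes "lin L" "loc_nonneg L d (\<lambda>_. 1)" "\<And>i. i \<in> I \<Longrightarrow> loc_nonneg L d (w i)"
  shows "loc_nonneg L d (\<lambda>x. \<Sum>i\<in>I. w i x)"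
  using assms(3)
  by (induction I rule: infinite_finite_induct)
     (simp_all add: loc_nonneg_const[OF assms(1,2)] loc_nonneg_add[OF assms(1)])

text \<open>The relaxed form of \<open>|f| \<le> c\<close>. Stating it by the single weight
  \<open>c^2 - f^2\<close>, rather than by \<open>c - f\<close> and \<open>c + f\<close>, makes it
  stable under sums and products through short identities.\<close>

definition loc_bound :: "((real^'n \<Rightarrow> real) \<Rightarrow> real) \<Rightarrow> nat \<Rightarrow> real \<Rightarrow> (real^'n \<Rightarrow> real) \<Rightarrow> bool" where
  "loc_bound L k c f \<longleftrightarrow> loc_nonneg L k (\<lambda>x. c\<^sup>2 - (f x)\<^sup>2)"

text \<open>Weighted Cauchy-Schwarz, \<open>(f + g)^2 \<le> (c + d) (f^2 / c + g^2 / d)\<close>, in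
  which the difference of the two sides is a positive multiple of a square. The division explains
  the strict positivity of both constants.\<close>

lemma loc_bound_add:
  assumes L: "lin L" and sq: "loc_nonneg L (k + e) (\<lambda>_. 1)"
    and f: "loc_bound L k c f" "pol e f" "0 < c" and g: "loc_bound L k d g" "pol e g" "0 < d"
  shows "loc_bound L k (c + d) (\<lambda>x. f x + g x)"
proof -
  have "loc_nonneg L k (\<lambda>x. (1 + d / c) * (c\<^sup>2 - (f x)\<^sup>2) + (1 + c / d) * (d\<^sup>2 - (g x)\<^sup>2)
      + (d / c) * (f x - (c / d) * g x)\<^sup>2)"
    using f g unfolding loc_bound_def
    by (intro loc_nonneg_add[OF L] loc_nonneg_scale[OF L] loc_nonneg_square[OF sq, of e] pol_diff pol_scale)
       auto
  moreover have "(\<lambda>x. (1 + d / c) * (c\<^sup>2 - (f x)\<^sup>2) + (1 + c / d) * (d\<^sup>2 - (g x)\<^sup>2)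
      + (d / c) * (f x - (c / d) * g x)\<^sup>2) = (\<lambda>x. (c + d)\<^sup>2 - (f x + g x)\<^sup>2)"
    using f(3) g(3) by (intro ext) (simp add: field_simps power2_eq_square)
  ultimately show ?thesis unfolding loc_bound_def by simp
qed

text \<open>By \<open>c^2 d^2 - f^2 g^2 = d^2 (c^2 - f^2) + f^2 (d^2 - g^2)\<close>; the factor
  \<open>f^2\<close> is the reason why the bound on \<open>g\<close> is needed at the higher order
  \<open>k + e\<close>.\<close>

lemma loc_bound_mult:
  assumes L: "lin L" and f: "loc_bound L k c f" "pol e f" and g: "loc_bound L (k + e) d g"
  shows "loc_bound L k (c * d) (\<lambda>x. f x * g x)"
proof -
  have "loc_nonneg L k (\<lambda>x. d\<^sup>2 * (c\<^sup>2 - (f x)\<^sup>2) + (f x)\<^sup>2 * (d\<^sup>2 - (g x)\<^sup>2))"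
    using f g unfolding loc_bound_def
    by (intro loc_nonneg_add[OF L] loc_nonneg_scale[OF L] loc_nonneg_square_mult[of L "k + e" _ e]) auto
  then show ?thesis unfolding loc_bound_def by (simp add: algebra_simps power_mult_distrib)
qed

lemma loc_bound_weaken:
  assumes L: "lin L" and sq: "loc_nonneg L k (\<lambda>_. 1)" and f: "loc_bound L k c f" and cd: "\<bar>c\<bar> \<le> d"
  shows "loc_bound L k d f"
proof -
  have "c\<^sup>2 \<le> d\<^sup>2" using cd by (simp add: abs_le_square_iff[symmetric])
  then have "loc_nonneg L k (\<lambda>x. (d\<^sup>2 - c\<^sup>2) + (c\<^sup>2 - (f x)\<^sup>2))"
    using f unfolding loc_bound_def by (intro loc_nonneg_add[OF L] loc_nonneg_const[OF L sq]) auto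
  then show ?thesis unfolding loc_bound_def by simp
qed

lemma loc_bound_const:
  assumes "lin L" "loc_nonneg L k (\<lambda>_. 1)" "\<bar>s\<bar> \<le> c"
  shows "loc_bound L k c (\<lambda>_. s)"
  unfolding loc_bound_def
  using loc_nonneg_const[OF assms(1,2), of "c\<^sup>2 - s\<^sup>2"] assms(3)
  by (simp add: abs_le_square_iff[symmetric])

lemma loc_bound_mono: "loc_bound L d c f \<Longrightarrow> k \<le> d \<Longrightarrow> loc_bound L k c f"
  unfolding loc_bound_def by (rule loc_nonneg_mono)

text \<open>From \<open>2 c (c - f) = (c - f)^2 + (c^2 - f^2)\<close>.\<close>

lemma loc_bound_imp_le:
  assumes L: "lin L" and sq: "loc_nonneg L (k + e) (\<lambda>_. 1)" and f: "loc_bound L k c f" "pol e f" "0 < c"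
  shows "loc_nonneg L k (\<lambda>x. c - f x)"
proof -
  have "loc_nonneg L k (\<lambda>x. (1 / (2 * c)) * ((c - f x)\<^sup>2 + (c\<^sup>2 - (f x)\<^sup>2)))"
    using f unfolding loc_bound_def
    by (intro loc_nonneg_add[OF L] loc_nonneg_scale[OF L] loc_nonneg_square[OF sq, of e] pol_diff pol_const)
       auto
  moreover have "(\<lambda>x. (1 / (2 * c)) * ((c - f x)\<^sup>2 + (c\<^sup>2 - (f x)\<^sup>2))) = (\<lambda>x. c - f x)"
    using f(3) by (intro ext) (simp add: field_simps power2_eq_square)
  ultimately show ?thesis by simp
qed

definition ball_fun :: "real^'n \<Rightarrow> real \<Rightarrow> real^'n \<Rightarrow> real" where
  "ball_fun u \<delta> x = \<delta>\<^sup>2 - (\<Sum>i\<in>UNIV. (x $ i - u $ i)\<^sup>2)"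

lemma ball_fun_nonneg_iff: "0 \<le> \<delta> \<Longrightarrow> 0 \<le> ball_fun u \<delta> x \<longleftrightarrow> norm (x - u) \<le> \<delta>"
proof -
  assume "0 \<le> \<delta>"
  have "(\<Sum>i\<in>UNIV. (x $ i - u $ i)\<^sup>2) = (norm (x - u))\<^sup>2"
    by (simp add: norm_vec_def L2_set_def sum_nonneg)
  then show ?thesis
    using abs_le_square_iff[of "norm (x - u)" \<delta>] \<open>0 \<le> \<delta>\<close> by (simp add: ball_fun_def)
qed

text \<open>Adding the squares of the other coordinates to the ball weight leaves only the square of
  the coordinate \<open>i\<close>.\<close>

lemma loc_bound_coord:
  assumes L: "lin L" and sq: "loc_nonneg L (Suc k) (\<lambda>_. 1)" and b: "loc_nonneg L k (ball_fun u \<delta>)"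
  shows "loc_bound L k \<delta> (\<lambda>x. x $ i - u $ i)"
proof -
  have "loc_nonneg L k (\<lambda>x. ball_fun u \<delta> x + (\<Sum>j\<in>UNIV - {i}. (x $ j - u $ j)\<^sup>2))"
    by (intro loc_nonneg_add[OF L] b loc_nonneg_sum[OF L loc_nonneg_mono[OF sq]]
         loc_nonneg_square[OF sq, of 1] pol_diff pol_coord pol_const) auto
  moreover have "ball_fun u \<delta> x + (\<Sum>j\<in>UNIV - {i}. (x $ j - u $ j)\<^sup>2) = \<delta>\<^sup>2 - (x $ i - u $ i)\<^sup>2" for x
    unfolding ball_fun_def by (subst sum.remove[of UNIV i]) auto
  ultimately show ?thesis unfolding loc_bound_def by simp
qed

text \<open>The order \<open>d\<close> must not depend on \<open>L\<close>, \<open>a\<close> and \<open>t\<close>: this replaces a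
  Positivstellensatz with degree bounds.\<close>

lemma loc_bound_near:
  fixes p :: "real^'n \<Rightarrow> real"
  assumes "pol e p" "0 < \<eta>"
  shows "\<exists>d \<delta>0. 0 < \<delta>0 \<and> (\<forall>\<delta> L a t. 0 < \<delta> \<and> \<delta> \<le> \<delta>0 \<and> lin L \<and> loc_nonneg L d (\<lambda>_. 1) \<and>
      loc_nonneg L d (ball_fun u \<delta>) \<and> norm (a - u) \<le> \<delta> \<and> 0 \<le> t \<and> t \<le> 1 \<longrightarrow>
      loc_bound L k \<eta> (\<lambda>x. p (a + t *\<^sub>R (x - a)) - p u))"
  using assms
proof (induction arbitrary: \<eta> k)
  case (pol_const d c)
  show ?case
    by (rule exI[of _ k], rule exI[of _ 1]) (use pol_const in \<open>auto intro!: loc_bound_const\<close>)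
next
  case (pol_coord d i)
  show ?case
  proof (rule exI[of _ "Suc k"], rule exI[of _ "\<eta> / 2"], intro conjI allI impI, goal_cases)
    case 1
    show ?case using pol_coord by simp
  next
    case (2 \<delta> L a t)
    then have L: "lin L" and sq: "loc_nonneg L (Suc k) (\<lambda>_. 1)" by auto
    have sq': "loc_nonneg L k (\<lambda>_. 1)" using sq by (rule loc_nonneg_mono) simp
    \<comment> \<open>The deviation is split as \<open>(1 - t) (a i - u i) + t (x i - u i)\<close>.
      The first summand is a number, the second is bounded through the ball weight; each takes
      \<open>\<eta> / 2\<close>, which fixes the radius.\<close>
    have "\<bar>a $ i - u $ i\<bar> \<le> \<delta>" using 2 component_le_norm_cart[of "a - u" i] by simp
    then have "\<bar>1 - t\<bar> * \<bar>a $ i - u $ i\<bar> \<le> 1 * \<delta>" using 2 by (intro mult_mono) auto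
    then have "loc_bound L k (\<eta> / 2) (\<lambda>_. (1 - t) * (a $ i - u $ i))"
      using 2 by (intro loc_bound_const[OF L sq']) (auto simp: abs_mult)
    moreover have "loc_bound L k (\<eta> / 2) (\<lambda>x. t * (x $ i - u $ i))"
    proof (rule loc_bound_weaken[OF L sq'])
      have "loc_bound L k 1 (\<lambda>_. t)" using 2 by (intro loc_bound_const[OF L sq']) auto
      moreover have "loc_nonneg L k (ball_fun u \<delta>)" using 2 loc_nonneg_mono by (metis le_SucI order_refl)
      ultimately show "loc_bound L k (1 * \<delta>) (\<lambda>x. t * (x $ i - u $ i))"
        using loc_bound_coord[OF L sq, of u \<delta> i]
        by (intro loc_bound_mult[OF L, of _ _ _ 0]) (auto intro: pol.pol_const)
    qed (use 2 in auto)
    moreover have "pol 1 (\<lambda>x. (1 - t) * (a $ i - u $ i))" "pol 1 (\<lambda>x. t * (x $ i - u $ i))"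
      by (rule pol.pol_const, intro pol_scale pol_diff pol.pol_coord pol.pol_const) simp
    ultimately have "loc_bound L k (\<eta> / 2 + \<eta> / 2) (\<lambda>x. (1 - t) * (a $ i - u $ i) + t * (x $ i - u $ i))"
      using pol_coord sq by (intro loc_bound_add[OF L, of _ 1]) auto
    then show ?case by (simp add: algebra_simps)
  qed
next
  case (pol_add e f g)
  have pos: "0 < \<eta> / 2" using pol_add by simp
  obtain d1 \<delta>1 where f: "0 < \<delta>1" "\<And>\<delta> L a t. 0 < \<delta> \<and> \<delta> \<le> \<delta>1 \<and> lin L \<and> loc_nonneg L d1 (\<lambda>_. 1) \<and>
      loc_nonneg L d1 (ball_fun u \<delta>) \<and> norm (a - u) \<le> \<delta> \<and> 0 \<le> t \<and> t \<le> 1 \<Longrightarrow>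
      loc_bound L k (\<eta> / 2) (\<lambda>x. f (a + t *\<^sub>R (x - a)) - f u)"
    using pol_add.IH(1)[OF pos, of k] by blast
  obtain d2 \<delta>2 where g: "0 < \<delta>2" "\<And>\<delta> L a t. 0 < \<delta> \<and> \<delta> \<le> \<delta>2 \<and> lin L \<and> loc_nonneg L d2 (\<lambda>_. 1) \<and>
      loc_nonneg L d2 (ball_fun u \<delta>) \<and> norm (a - u) \<le> \<delta> \<and> 0 \<le> t \<and> t \<le> 1 \<Longrightarrow>
      loc_bound L k (\<eta> / 2) (\<lambda>x. g (a + t *\<^sub>R (x - a)) - g u)"
    using pol_add.IH(2)[OF pos, of k] by blast
  show ?case
  proof (rule exI[of _ "d1 + d2 + (k + e)"], rule exI[of _ "min \<delta>1 \<delta>2"], intro conjI allI impI, goal_cases)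
    case 1
    show ?case using f(1) g(1) by simp
  next
    case (2 \<delta> L a t)
    then have L: "lin L" and sq: "loc_nonneg L (k + e) (\<lambda>_. 1)"
      by (auto elim: loc_nonneg_mono)
    have "loc_bound L k (\<eta> / 2 + \<eta> / 2) (\<lambda>x. (f (a + t *\<^sub>R (x - a)) - f u) + (g (a + t *\<^sub>R (x - a)) - g u))"
    proof (rule loc_bound_add[OF L sq])
      show "loc_bound L k (\<eta> / 2) (\<lambda>x. f (a + t *\<^sub>R (x - a)) - f u)"
        by (rule f(2)[of \<delta>]) (use 2 in \<open>auto elim: loc_nonneg_mono\<close>)
      show "loc_bound L k (\<eta> / 2) (\<lambda>x. g (a + t *\<^sub>R (x - a)) - g u)"
        by (rule g(2)[of \<delta>]) (use 2 in \<open>auto elim: loc_nonneg_mono\<close>)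
    qed (use pos pol_add.hyps in \<open>auto intro!: pol_diff pol.pol_const pol_affine_line\<close>)
    then show ?case by (simp add: algebra_simps)
  qed
next
  case (pol_mult b f c g e)
  \<comment> \<open>With \<open>F\<close> and \<open>G\<close> the deviations of the two factors,
    the deviation of the product is \<open>F G + f(u) G + g(u) F\<close>, bounded by
    \<open>\<epsilon>^2 + A \<epsilon> + B \<epsilon>\<close>. As \<open>\<epsilon> \<le> 1\<close>,
    the choice of \<open>\<epsilon>\<close> makes this at most \<open>\<eta>\<close>. The added 1
    keeps \<open>A\<close> and \<open>B\<close> positive for \<open>loc_bound_add\<close>, and
    \<open>k'\<close> leaves room for the degrees of \<open>F\<close> and \<open>G\<close>.\<close>
  define A where "A = \<bar>f u\<bar> + 1"
  define B where "B = \<bar>g u\<bar> + 1"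
  define \<epsilon> where "\<epsilon> = min 1 (\<eta> / (A + B + 1))"
  define k' where "k' = k + (b + c)"
  have A: "0 < A" "\<bar>f u\<bar> \<le> A" and B: "0 < B" "\<bar>g u\<bar> \<le> B" by (auto simp: A_def B_def)
  have \<epsilon>: "0 < \<epsilon>" "\<epsilon> \<le> 1" using A B pol_mult.prems by (auto simp: \<epsilon>_def)
  have "\<epsilon> * (A + B + 1) \<le> \<eta>"
    using A B unfolding pos_le_divide_eq[of "A + B + 1", symmetric, OF add_pos_pos[OF add_pos_pos[OF A(1) B(1)] zero_less_one]]
    by (simp add: \<epsilon>_def)
  moreover have "\<epsilon> * \<epsilon> \<le> \<epsilon> * 1" using \<epsilon> by (intro mult_left_mono) auto
  ultimately have total: "\<epsilon> * \<epsilon> + A * \<epsilon> + B * \<epsilon> \<le> \<eta>" by (simp add: algebra_simps)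
  obtain d1 \<delta>1 where f: "0 < \<delta>1" "\<And>\<delta> L a t. 0 < \<delta> \<and> \<delta> \<le> \<delta>1 \<and> lin L \<and> loc_nonneg L d1 (\<lambda>_. 1) \<and>
      loc_nonneg L d1 (ball_fun u \<delta>) \<and> norm (a - u) \<le> \<delta> \<and> 0 \<le> t \<and> t \<le> 1 \<Longrightarrow>
      loc_bound L k' \<epsilon> (\<lambda>x. f (a + t *\<^sub>R (x - a)) - f u)"
    using pol_mult.IH(1)[OF \<epsilon>(1), of k'] by blast
  obtain d2 \<delta>2 where g: "0 < \<delta>2" "\<And>\<delta> L a t. 0 < \<delta> \<and> \<delta> \<le> \<delta>2 \<and> lin L \<and> loc_nonneg L d2 (\<lambda>_. 1) \<and>
      loc_nonneg L d2 (ball_fun u \<delta>) \<and> norm (a - u) \<le> \<delta> \<and> 0 \<le> t \<and> t \<le> 1 \<Longrightarrow>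
      loc_bound L k' \<epsilon> (\<lambda>x. g (a + t *\<^sub>R (x - a)) - g u)"
    using pol_mult.IH(2)[OF \<epsilon>(1), of k'] by blast
  show ?case
  proof (rule exI[of _ "d1 + d2 + k'"], rule exI[of _ "min \<delta>1 \<delta>2"], intro conjI allI impI, goal_cases)
    case 1
    show ?case using f(1) g(1) by simp
  next
    case (2 \<delta> L a t)
    then have L: "lin L" and sq: "loc_nonneg L (k + (b + c)) (\<lambda>_. 1)"
      by (auto simp: k'_def elim: loc_nonneg_mono)
    have sq': "loc_nonneg L k (\<lambda>_. 1)" using sq by (rule loc_nonneg_mono) simp
    define F where "F x = f (a + t *\<^sub>R (x - a)) - f u" for x
    define G where "G x = g (a + t *\<^sub>R (x - a)) - g u" for x
    have F: "loc_bound L k' \<epsilon> F"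
      unfolding F_def[abs_def] by (rule f(2)[of \<delta>]) (use 2 in \<open>auto elim: loc_nonneg_mono\<close>)
    have G: "loc_bound L k' \<epsilon> G"
      unfolding G_def[abs_def] by (rule g(2)[of \<delta>]) (use 2 in \<open>auto elim: loc_nonneg_mono\<close>)
    have pF: "pol b F" and pG: "pol c G"
      unfolding F_def[abs_def] G_def[abs_def] using pol_mult.hyps
      by (auto intro!: pol_diff pol.pol_const pol_affine_line)
    have Fk: "loc_bound L k \<epsilon> F" and Gk: "loc_bound L k \<epsilon> G" and Gb: "loc_bound L (k + b) \<epsilon> G"
      using F G by (auto simp: k'_def elim: loc_bound_mono)
    have FG: "loc_bound L k (\<epsilon> * \<epsilon>) (\<lambda>x. F x * G x)"
      by (rule loc_bound_mult[OF L Fk pF Gb])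
    have fG: "loc_bound L k (A * \<epsilon>) (\<lambda>x. f u * G x)"
      by (rule loc_bound_mult[OF L loc_bound_const[OF L sq' A(2)] pol.pol_const[of 0]]) (simp add: Gk)
    have gF: "loc_bound L k (B * \<epsilon>) (\<lambda>x. g u * F x)"
      by (rule loc_bound_mult[OF L loc_bound_const[OF L sq' B(2)] pol.pol_const[of 0]]) (simp add: Fk)
    have p1: "pol (b + c) (\<lambda>x. F x * G x)" by (rule pol.pol_mult[OF pF pG order_refl])
    have p2: "pol (b + c) (\<lambda>x. f u * G x)" by (intro pol_scale pol_mono[OF pG]) simp
    have p3: "pol (b + c) (\<lambda>x. g u * F x)" by (intro pol_scale pol_mono[OF pF]) simp
    have "loc_bound L k (\<epsilon> * \<epsilon> + A * \<epsilon> + B * \<epsilon>) (\<lambda>x. F x * G x + f u * G x + g u * F x)"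
      using A B \<epsilon> by (intro loc_bound_add[OF L sq] FG fG gF p1 p2 p3 pol.pol_add) (auto intro: add_pos_pos)
    then have "loc_bound L k \<eta> (\<lambda>x. F x * G x + f u * G x + g u * F x)"
      by (rule loc_bound_weaken[OF L sq']) (use A B \<epsilon> total in simp)
    moreover have "(\<lambda>x. F x * G x + f u * G x + g u * F x) =
        (\<lambda>x. f (a + t *\<^sub>R (x - a)) * g (a + t *\<^sub>R (x - a)) - f u * g u)"
      by (simp add: fun_eq_iff F_def G_def algebra_simps)
    ultimately show ?case by simp
  qed
qed

section \<open>Quadratic forms\<close>

text \<open>Cholesky factorization by elimination of one index at a time. Definiteness passes to the
  Schur complement and keeps every pivot positive.\<close>

lemma posdef_factor:
  fixes A :: "'i \<Rightarrow> 'i \<Rightarrow> real"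
  assumes "finite I" "\<And>i j. i \<in> I \<Longrightarrow> j \<in> I \<Longrightarrow> A i j = A j i"
    and "\<And>z. (\<exists>i\<in>I. z i \<noteq> 0) \<Longrightarrow> 0 < (\<Sum>i\<in>I. \<Sum>j\<in>I. A i j * (z i * z j))"
  shows "\<exists>(m::nat) b. \<forall>i\<in>I. \<forall>j\<in>I. A i j = (\<Sum>l<m. b l i * b l j)"
  using assms
proof (induction I arbitrary: A rule: finite_induct)
  case (insert k I)
  define s where "s = A k k"
  have "0 < (\<Sum>i\<in>insert k I. \<Sum>j\<in>insert k I. A i j * ((if i = k then 1 else 0) * (if j = k then 1 else 0)))"
    by (rule insert.prems(2)) auto
  also have "\<dots> = s"
  proof -
    have "A i j * ((if i = k then 1 else 0) * (if j = k then 1 else 0)) =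
        (if j = k then if i = k then A i k else 0 else 0)" for i j by simp
    then show ?thesis using insert.hyps(1) by (simp add: s_def del: sum.insert)
  qed
  finally have s: "0 < s" .
  \<comment> \<open>The Schur complement of the pivot \<open>s\<close>.\<close>
  define A' where "A' i j = A i j - A i k * A k j / s" for i j
  have sym: "A i j = A j i" if "i \<in> insert k I" "j \<in> insert k I" for i j
    using insert.prems(1) that by blast
  have "\<exists>(m::nat) b. \<forall>i\<in>I. \<forall>j\<in>I. A' i j = (\<Sum>l<m. b l i * b l j)"
  proof (rule insert.IH)
    show "A' i j = A' j i" if "i \<in> I" "j \<in> I" for i j
      using that sym by (simp add: A'_def)
    show "0 < (\<Sum>i\<in>I. \<Sum>j\<in>I. A' i j * (z i * z j))" if z: "\<exists>i\<in>I. z i \<noteq> 0" for z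
    proof -
      define S where "S = (\<Sum>j\<in>I. A k j * z j)"
      \<comment> \<open>The extension of \<open>z\<close> to the index \<open>k\<close> that
        minimizes the form of \<open>A\<close>; the minimum is the value of the form of
        \<open>A'\<close> at \<open>z\<close>.\<close>
      define y where "y i = (if i = k then - S / s else z i)" for i
      have yI: "y i = z i" if "i \<in> I" for i using that insert.hyps(2) by (auto simp: y_def)
      have S': "(\<Sum>i\<in>I. A i k * z i) = S" unfolding S_def using sym by (intro sum.cong) auto
      have "0 < (\<Sum>i\<in>insert k I. \<Sum>j\<in>insert k I. A i j * (y i * y j))"
        using z yI by (intro insert.prems(2)) auto
      also have "\<dots> = s * (y k * y k) + (\<Sum>j\<in>I. A k j * (y k * z j)) + (\<Sum>i\<in>I. A i k * (z i * y k))
          + (\<Sum>i\<in>I. \<Sum>j\<in>I. A i j * (z i * z j))"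
        using insert.hyps yI by (simp add: sum.distrib s_def)
      also have "(\<Sum>j\<in>I. A k j * (y k * z j)) = y k * S"
        by (simp add: S_def sum_distrib_left mult_ac)
      also have "(\<Sum>i\<in>I. A i k * (z i * y k)) = y k * S"
        by (simp add: S'[symmetric] sum_distrib_left mult_ac)
      also have "s * (y k * y k) + y k * S + y k * S = - (S * S / s)"
        using s by (simp add: y_def field_simps)
      also have "S * S / s = (\<Sum>i\<in>I. \<Sum>j\<in>I. A i k * A k j / s * (z i * z j))"
        unfolding S'[symmetric, THEN arg_cong[of _ _ "\<lambda>r. r * S / s"]]
        unfolding S_def by (simp add: sum_product sum_divide_distrib mult_ac)
      finally show ?thesis by (simp add: A'_def left_diff_distrib sum_subtractf)
    qed
  qed
  then obtain m :: nat and b where b: "\<And>i j. i \<in> I \<Longrightarrow> j \<in> I \<Longrightarrow> A' i j = (\<Sum>l<m. b l i * b l j)" by blast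
  \<comment> \<open>The factors of \<open>A'\<close>, extended by zero at \<open>k\<close>, and one
    new factor with index \<open>m\<close>, the scaled row of the pivot.\<close>
  define c where "c l i = (if l = m then A k i / sqrt s else if i = k then 0 else b l i)" for l :: nat and i
  have "A i j = (\<Sum>l<Suc m. c l i * c l j)" if "i \<in> insert k I" "j \<in> insert k I" for i j
  proof -
    have "(\<Sum>l<m. c l i * c l j) = (if i = k \<or> j = k then 0 else A' i j)"
      using that b by (auto simp: c_def)
    moreover have "c m i * c m j = A i k * A k j / s"
      using s that sym[of i k] by (simp add: c_def)
    moreover have "A i j = A i k * A k j / s" if "i = k \<or> j = k"
      using that s by (auto simp: s_def)
    ultimately show ?thesis by (auto simp: A'_def)
  qed
  then show ?case by blast
qed simp

text \<open>On the part of the unit sphere where the quadratic form is nonnegative, the linear form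
  has no zero; by compactness its square is bounded below there, so a large multiple beats the
  quadratic form. Homogeneity does the rest. The factor 2 is the one in the Hessian of
  \<open>g - c g^2\<close> at a zero of \<open>g\<close>.\<close>

lemma finsler_penalty:
  fixes Q :: "'n::finite \<Rightarrow> 'n \<Rightarrow> real" and l :: "'n \<Rightarrow> real"
  assumes neg: "\<And>v::real^'n. v \<noteq> 0 \<Longrightarrow> (\<Sum>i\<in>UNIV. l i * v $ i) = 0 \<Longrightarrow>
      (\<Sum>i\<in>UNIV. \<Sum>j\<in>UNIV. Q i j * (v $ i * v $ j)) < 0"
  shows "\<exists>c \<epsilon>. 0 < \<epsilon> \<and> (\<forall>v::real^'n. (\<Sum>i\<in>UNIV. \<Sum>j\<in>UNIV. Q i j * (v $ i * v $ j))
      - 2 * c * (\<Sum>i\<in>UNIV. l i * v $ i)\<^sup>2 \<le> - \<epsilon> * (norm v)\<^sup>2)"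
proof -
  define f where "f v = (\<Sum>i\<in>UNIV. \<Sum>j\<in>UNIV. Q i j * (v $ i * v $ j))" for v :: "real^'n"
  define g where "g v = (\<Sum>i\<in>UNIV. l i * v $ i)" for v :: "real^'n"
  have cf: "continuous_on A f" and cg: "continuous_on A g" for A
    unfolding f_def[abs_def] g_def[abs_def] by (intro continuous_intros)+
  have neg': "f v < 0" if "v \<noteq> 0" "g v = 0" for v using neg that by (simp add: f_def g_def)
  define B where "B = {v \<in> sphere 0 1. 0 \<le> f v}"
  have "\<exists>c. \<forall>v\<in>sphere 0 1. f v - 2 * c * (g v)\<^sup>2 < 0"
  proof (cases "B = {}")
    case True
    then show ?thesis by (intro exI[of _ 0]) (auto simp: B_def not_le)
  next
    case False
    have "closed {v. 0 \<le> f v}" by (intro closed_Collect_le continuous_on_const cf)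
    then have B: "compact B" unfolding B_def Collect_conj_eq
      using compact_Int_closed[OF compact_sphere, of "{v. 0 \<le> f v}" 0 1] by (simp add: sphere_def)
    obtain v0 where v0: "v0 \<in> B" "\<And>v. v \<in> B \<Longrightarrow> (g v0)\<^sup>2 \<le> (g v)\<^sup>2"
      using continuous_attains_inf[OF B False, of "\<lambda>v. (g v)\<^sup>2"] cg by (auto intro: continuous_on_power)
    obtain v1 where v1: "v1 \<in> B" "\<And>v. v \<in> B \<Longrightarrow> f v \<le> f v1"
      using continuous_attains_sup[OF B False cf] by auto
    have "v0 \<noteq> 0" "0 \<le> f v0" using v0(1) by (auto simp: B_def)
    then have \<mu>: "0 < (g v0)\<^sup>2" using neg'[of v0] by (cases "g v0 = 0") auto
    have M: "0 \<le> f v1" using v1(1) by (simp add: B_def)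
    \<comment> \<open>Makes \<open>c (g v)^2\<close> at least the maximum of \<open>f\<close> on
      \<open>B\<close> plus 1, so the penalized form is negative on \<open>B\<close>; outside
      \<open>B\<close> it is negative because \<open>f\<close> is and
      \<open>c \<ge> 0\<close>.\<close>
    define c where "c = (f v1 + 1) / (g v0)\<^sup>2"
    have c: "0 \<le> c" using M \<mu> by (simp add: c_def)
    have "f v - 2 * c * (g v)\<^sup>2 < 0" if v: "v \<in> sphere 0 1" for v
    proof (cases "v \<in> B")
      case True
      have "c * (g v0)\<^sup>2 \<le> c * (g v)\<^sup>2" using v0(2)[OF True] c by (rule mult_left_mono)
      moreover have "c * (g v0)\<^sup>2 = f v1 + 1" using \<mu> by (simp add: c_def)
      ultimately show ?thesis using v1(2)[OF True] M by linarith
    next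
      case False
      then have "f v < 0" using v by (auto simp: B_def not_le)
      moreover have "0 \<le> c * (g v)\<^sup>2" using c by simp
      ultimately show ?thesis by linarith
    qed
    then show ?thesis by blast
  qed
  then obtain c where c: "\<And>v. v \<in> sphere 0 1 \<Longrightarrow> f v - 2 * c * (g v)\<^sup>2 < 0" by blast
  have "sphere 0 1 \<noteq> ({} :: (real^'n) set)" by simp
  moreover have "continuous_on (sphere 0 1) (\<lambda>v. f v - 2 * c * (g v)\<^sup>2)"
    by (intro continuous_intros cf cg)
  ultimately obtain w where w: "w \<in> sphere (0::real^'n) 1"
    "\<And>v. v \<in> sphere 0 1 \<Longrightarrow> f v - 2 * c * (g v)\<^sup>2 \<le> f w - 2 * c * (g w)\<^sup>2"
    using continuous_attains_sup[OF compact_sphere, of 0 1 "\<lambda>v. f v - 2 * c * (g v)\<^sup>2"] by blast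
  define \<epsilon> where "\<epsilon> = - (f w - 2 * c * (g w)\<^sup>2)"
  have "f v - 2 * c * (g v)\<^sup>2 \<le> - \<epsilon> * (norm v)\<^sup>2" for v
  proof (cases "v = 0")
    case True
    then show ?thesis by (simp add: f_def g_def)
  next
    case False
    define z where "z = (1 / norm v) *\<^sub>R v"
    have v: "v = norm v *\<^sub>R z" and z: "z \<in> sphere 0 1" using False by (simp_all add: z_def)
    have "f v = (norm v)\<^sup>2 * f z"
      by (subst v) (simp add: f_def sum_distrib_left power2_eq_square mult_ac)
    moreover have "g v = norm v * g z"
      by (subst v) (simp add: g_def sum_distrib_left mult_ac)
    ultimately have "f v - 2 * c * (g v)\<^sup>2 = (norm v)\<^sup>2 * (f z - 2 * c * (g z)\<^sup>2)"
      by (simp add: algebra_simps power_mult_distrib)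
    also have "\<dots> \<le> (norm v)\<^sup>2 * (- \<epsilon>)"
      using w(2)[OF z] by (intro mult_left_mono) (auto simp: \<epsilon>_def)
    finally show ?thesis by (simp add: mult.commute)
  qed
  moreover have "0 < \<epsilon>" using c[OF w(1)] by (simp add: \<epsilon>_def)
  ultimately show ?thesis unfolding f_def g_def by blast
qed

text \<open>Adding \<open>|x - a|^2\<close> to the ball weight cancels its quadratic part and leaves
  an affine function of \<open>x\<close>. On this \<open>L\<close> acts as evaluation at
  \<open>a\<close>, where it equals the ball weight at \<open>a\<close>.\<close>

lemma barycentre_in_ball:
  assumes L: "lin L" and L1: "L (\<lambda>_. 1) = 1" and La: "\<And>i. L (\<lambda>x. x $ i) = a $ i"
    and sq: "loc_nonneg L 1 (\<lambda>_. 1)" and b: "loc_nonneg L k (ball_fun u \<delta>)" and \<delta>: "0 \<le> \<delta>"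
  shows "norm (a - u) \<le> \<delta>"
proof -
  have Lc: "L (\<lambda>_. c) = c" for c using lin_scale[OF L, of c "\<lambda>_. 1"] L1 by simp
  have "0 \<le> L (\<lambda>x. \<Sum>i\<in>UNIV. (x $ i - a $ i)\<^sup>2)"
    by (intro loc_nonneg_functional[of L 0] loc_nonneg_sum[OF L loc_nonneg_mono[OF sq]]
         loc_nonneg_square[OF sq, of 1] pol_diff pol_coord pol_const) auto
  then have "0 \<le> L (\<lambda>x. ball_fun u \<delta> x + (\<Sum>i\<in>UNIV. (x $ i - a $ i)\<^sup>2))"
    using loc_nonneg_functional[OF b] by (simp add: lin_add[OF L])
  also have "(\<lambda>x. ball_fun u \<delta> x + (\<Sum>i\<in>UNIV. (x $ i - a $ i)\<^sup>2)) =
      (\<lambda>x. ball_fun u \<delta> a - (\<Sum>i\<in>UNIV. (2 * (a $ i - u $ i)) * (x $ i - a $ i)))"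
  proof
    fix x
    have "(\<Sum>i\<in>UNIV. (x $ i - u $ i)\<^sup>2) = (\<Sum>i\<in>UNIV. (x $ i - a $ i)\<^sup>2 + (a $ i - u $ i)\<^sup>2
        + (2 * (a $ i - u $ i)) * (x $ i - a $ i))"
      by (intro sum.cong refl) (simp add: power2_eq_square algebra_simps)
    then show "ball_fun u \<delta> x + (\<Sum>i\<in>UNIV. (x $ i - a $ i)\<^sup>2) =
        ball_fun u \<delta> a - (\<Sum>i\<in>UNIV. (2 * (a $ i - u $ i)) * (x $ i - a $ i))"
      unfolding ball_fun_def sum.distrib by simp
  qed
  also have "L \<dots> = ball_fun u \<delta> a"
    unfolding lin_diff[OF L] lin_sum[OF L] lin_scale[OF L] by (simp add: Lc La lin_diff[OF L])
  finally show ?thesis using ball_fun_nonneg_iff[OF \<delta>, of u a] by simp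
qed

text \<open>The second derivative along a segment is minus the sum of the squares of the entries of
  \<open>W(a + t (x - a)) (x - a)\<close>. These have degree at most \<open>e + 1\<close> whatever
  \<open>a\<close> and \<open>t\<close> are, so a moment condition of that order suffices and no
  localization is involved.\<close>

lemma lin_jensen_sos:
  assumes L: "lin L" and L1: "L (\<lambda>_. 1) = 1" and La: "\<And>i. L (\<lambda>x. x $ i) = a $ i"
    and h: "pol d h" and q: "has_partials h q" and qq: "\<And>i. has_partials (q i) (qq i)"
    and W: "\<And>l i. l < r \<Longrightarrow> pol e (W l i)"
    and sos: "\<And>i j x. - qq i j x = (\<Sum>l<(r::nat). W l i x * W l j x)"
    and sq: "loc_nonneg L (e + 1) (\<lambda>_. 1)"
  shows "L h \<le> h a"
proof (rule lin_jensen[OF L L1 La h q qq])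
  fix t :: real
  have eq: "(\<Sum>i\<in>UNIV. \<Sum>j\<in>UNIV. qq i j y * (v i * v j)) = (-1) * (\<Sum>l<r. (\<Sum>i\<in>UNIV. W l i y * v i)\<^sup>2)" for y v
  proof -
    have "(\<Sum>i\<in>UNIV. \<Sum>j\<in>UNIV. qq i j y * (v i * v j)) =
        (\<Sum>i\<in>UNIV. \<Sum>j\<in>UNIV. \<Sum>l<r. - ((W l i y * v i) * (W l j y * v j)))"
    proof (intro sum.cong refl)
      fix i j
      have "qq i j y * (v i * v j) = - (- qq i j y) * (v i * v j)" by simp
      also have "\<dots> = (\<Sum>l<r. - ((W l i y * v i) * (W l j y * v j)))"
        unfolding sos by (simp add: sum_distrib_left sum_distrib_right sum_negf mult_ac)
      finally show "qq i j y * (v i * v j) = (\<Sum>l<r. - ((W l i y * v i) * (W l j y * v j)))" .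
    qed
    also have "\<dots> = (\<Sum>i\<in>UNIV. \<Sum>l<r. \<Sum>j\<in>UNIV. - ((W l i y * v i) * (W l j y * v j)))"
      by (intro sum.cong refl sum.swap)
    also have "\<dots> = (\<Sum>l<r. \<Sum>i\<in>UNIV. \<Sum>j\<in>UNIV. - ((W l i y * v i) * (W l j y * v j)))"
      by (rule sum.swap)
    also have "\<dots> = (-1) * (\<Sum>l<r. (\<Sum>i\<in>UNIV. W l i y * v i)\<^sup>2)"
      by (simp add: power2_eq_square sum_product sum_negf)
    finally show ?thesis .
  qed
  have "L (\<lambda>x. \<Sum>i\<in>UNIV. \<Sum>j\<in>UNIV. qq i j (a + t *\<^sub>R (x - a)) * ((x $ i - a $ i) * (x $ j - a $ j))) =
      (-1) * L (\<lambda>x. \<Sum>l<r. (\<Sum>i\<in>UNIV. W l i (a + t *\<^sub>R (x - a)) * (x $ i - a $ i))\<^sup>2)"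
    unfolding eq by (rule lin_scale[OF L])
  moreover have "0 \<le> L (\<lambda>x. \<Sum>l<r. (\<Sum>i\<in>UNIV. W l i (a + t *\<^sub>R (x - a)) * (x $ i - a $ i))\<^sup>2)"
  proof (intro loc_nonneg_functional[of L 0] loc_nonneg_sum[OF L loc_nonneg_mono[OF sq]]
      loc_nonneg_square[OF sq, of "e + 1"] pol_sum)
    fix l i assume "l \<in> {..<r}"
    then have "pol e (\<lambda>x. W l i (a + t *\<^sub>R (x - a)))"
      by (intro pol_affine_line W) simp
    moreover have "pol 1 (\<lambda>x. x $ i - a $ i)"
      by (intro pol_diff pol_coord pol_const) simp
    ultimately show "pol (e + 1) (\<lambda>x. W l i (a + t *\<^sub>R (x - a)) * (x $ i - a $ i))"
      by (rule pol_mult) simp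
  qed auto
  ultimately show "L (\<lambda>x. \<Sum>i\<in>UNIV. \<Sum>j\<in>UNIV.
      qq i j (a + t *\<^sub>R (x - a)) * ((x $ i - a $ i) * (x $ j - a $ j))) \<le> 0" by simp
qed

text \<open>Pairs a positive definite matrix with the matrix of second moments of \<open>L\<close>
  around \<open>a\<close>. Factorization writes the quadratic form in \<open>x - a\<close> as a sum
  of squares of affine functions, which is all that a condition of order 1 can see.\<close>

lemma lin_quadratic_form_nonneg:
  fixes L :: "(real^'n \<Rightarrow> real) \<Rightarrow> real"
  assumes L: "lin L" and sq: "loc_nonneg L 1 (\<lambda>_. 1)" and sym: "\<And>i j. A i j = A j i"
    and pos: "\<And>z. (\<exists>i\<in>UNIV. z i \<noteq> 0) \<Longrightarrow> 0 < (\<Sum>i\<in>UNIV. \<Sum>j\<in>UNIV. A i j * (z i * z j))"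
  shows "0 \<le> (\<Sum>i\<in>UNIV. \<Sum>j\<in>UNIV. A i j * L (\<lambda>x. (x $ i - a $ i) * (x $ j - a $ j)))"
proof -
  obtain m b where b: "\<And>i j. A i j = (\<Sum>l<(m::nat). b l i * b l j)"
    using posdef_factor[of UNIV A] sym pos by auto
  have "0 \<le> L (\<lambda>x. \<Sum>l<m. (\<Sum>i\<in>UNIV. b l i * (x $ i - a $ i))\<^sup>2)"
    by (intro loc_nonneg_functional[of L 0] loc_nonneg_sum[OF L loc_nonneg_mono[OF sq]]
        loc_nonneg_square[OF sq, of 1] pol_sum pol_scale pol_diff pol_coord pol_const) auto
  also have "\<dots> = (\<Sum>l<m. \<Sum>i\<in>UNIV. \<Sum>j\<in>UNIV. (b l i * b l j) * L (\<lambda>x. (x $ i - a $ i) * (x $ j - a $ j)))"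
  proof -
    have "(\<Sum>i\<in>UNIV. b l i * (x $ i - a $ i))\<^sup>2 =
        (\<Sum>i\<in>UNIV. \<Sum>j\<in>UNIV. (b l i * b l j) * ((x $ i - a $ i) * (x $ j - a $ j)))" for l x
      unfolding power2_eq_square sum_product by (intro sum.cong refl) simp
    then show ?thesis by (simp only: lin_sum[OF L] lin_scale[OF L])
  qed
  also have "\<dots> = (\<Sum>i\<in>UNIV. \<Sum>l<m. \<Sum>j\<in>UNIV. (b l i * b l j) * L (\<lambda>x. (x $ i - a $ i) * (x $ j - a $ j)))"
    by (rule sum.swap)
  also have "\<dots> = (\<Sum>i\<in>UNIV. \<Sum>j\<in>UNIV. \<Sum>l<m. (b l i * b l j) * L (\<lambda>x. (x $ i - a $ i) * (x $ j - a $ j)))"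
    by (intro sum.cong refl sum.swap)
  also have "\<dots> = (\<Sum>i\<in>UNIV. \<Sum>j\<in>UNIV. A i j * L (\<lambda>x. (x $ i - a $ i) * (x $ j - a $ j)))"
    by (simp add: b sum_distrib_right)
  finally show ?thesis .
qed

text \<open>Along the segments each second partial is its value at \<open>u\<close> plus a small
  error \<open>F\<close>. With \<open>M\<close> the second moments around \<open>a\<close>, the
  constant part contributes at most \<open>- \<epsilon> / 2\<close> times the trace of
  \<open>M\<close>, and the errors contribute at most \<open>\<epsilon> / 2\<close> times the same
  trace.\<close>

lemma lin_jensen_near:
  fixes h :: "real^'n \<Rightarrow> real"
  assumes h: "pol e h" and q: "has_partials h q" and qq: "\<And>i. has_partials (q i) (qq i)"
    and poly: "\<And>i j. real_polynomial_function (qq i j)" and \<epsilon>: "0 < \<epsilon>"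
    and neg: "\<And>v::real^'n. (\<Sum>i\<in>UNIV. \<Sum>j\<in>UNIV. qq i j u * (v $ i * v $ j)) \<le> - \<epsilon> * (norm v)\<^sup>2"
  shows "\<exists>d \<delta>0. 0 < \<delta>0 \<and> (\<forall>\<delta> L a. 0 < \<delta> \<and> \<delta> \<le> \<delta>0 \<and> lin L \<and> L (\<lambda>_. 1) = 1 \<and>
      (\<forall>i. L (\<lambda>x. x $ i) = a $ i) \<and> loc_nonneg L d (\<lambda>_. 1) \<and> loc_nonneg L d (ball_fun u \<delta>) \<longrightarrow> L h \<le> h a)"
proof -
  define n where "n = real CARD('n)"
  have n: "0 < n" by (simp add: n_def)
  \<comment> \<open>Each error entry is charged \<open>\<eta> / 2\<close> times two diagonal
    moments. Summed over all pairs of indices this is \<open>\<eta> n\<close> times the trace, which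
    has to equal \<open>\<epsilon> / 2\<close> times the trace.\<close>
  define \<eta> where "\<eta> = \<epsilon> / (2 * n)"
  have \<eta>: "0 < \<eta>" using \<epsilon> n by (simp add: \<eta>_def)
  have "\<forall>i j. \<exists>d. pol d (qq i j)" using real_polynomial_function_imp_pol[OF poly] by blast
  then obtain e' where e': "\<And>i j. pol (e' i j) (qq i j)" by metis
  have "\<forall>i j. \<exists>d \<delta>0. 0 < \<delta>0 \<and> (\<forall>\<delta> L a t. 0 < \<delta> \<and> \<delta> \<le> \<delta>0 \<and> lin L \<and> loc_nonneg L d (\<lambda>_. 1) \<and>
      loc_nonneg L d (ball_fun u \<delta>) \<and> norm (a - u) \<le> \<delta> \<and> 0 \<le> t \<and> t \<le> 1 \<longrightarrow>
      loc_bound L 1 \<eta> (\<lambda>x. qq i j (a + t *\<^sub>R (x - a)) - qq i j u))"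
    using loc_bound_near[OF e' \<eta>] by blast
  then obtain D R where R: "\<And>i j. 0 < R i j" and D: "\<And>i j \<delta> L a t. 0 < \<delta> \<Longrightarrow> \<delta> \<le> R i j \<Longrightarrow> lin L \<Longrightarrow>
      loc_nonneg L (D i j) (\<lambda>_. 1) \<Longrightarrow> loc_nonneg L (D i j) (ball_fun u \<delta>) \<Longrightarrow>
      norm (a - u) \<le> \<delta> \<Longrightarrow> 0 \<le> t \<Longrightarrow> t \<le> 1 \<Longrightarrow>
      loc_bound L 1 \<eta> (\<lambda>x. qq i j (a + t *\<^sub>R (x - a)) - qq i j u)"
    by metis
  \<comment> \<open>Dominates both the orders \<open>D i j\<close>, which the bounds on the errors
    require, and \<open>1 + e' i j\<close>, which \<open>loc_bound_imp_le\<close> requires at order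
    1.\<close>
  define d where "d = 1 + Max (range (\<lambda>(i, j). D i j + e' i j))"
  define \<delta>0 where "\<delta>0 = Min (range (\<lambda>(i, j). R i j))"
  have dd: "1 + (D i j + e' i j) \<le> d" for i j
    unfolding d_def using Max_ge[OF finite_imageI[OF finite] rangeI, of "\<lambda>(i, j). D i j + e' i j" "(i, j)"] by simp
  have \<delta>0: "0 < \<delta>0" unfolding \<delta>0_def using R by (subst Min_gr_iff) auto
  have \<delta>R: "\<delta>0 \<le> R i j" for i j
    unfolding \<delta>0_def using Min_le[OF finite_imageI[OF finite] rangeI, of "\<lambda>(i, j). R i j" "(i, j)"] by simp
  show ?thesis
  proof (rule exI[of _ d], rule exI[of _ \<delta>0], intro conjI allI impI \<delta>0)
    fix \<delta> L a
    assume asm: "0 < \<delta> \<and> \<delta> \<le> \<delta>0 \<and> lin L \<and> L (\<lambda>_. 1) = 1 \<and>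
      (\<forall>i. L (\<lambda>x. x $ i) = a $ i) \<and> loc_nonneg L d (\<lambda>_. 1) \<and> loc_nonneg L d (ball_fun u \<delta>)"
    then have \<delta>: "0 < \<delta>" "\<delta> \<le> \<delta>0" and L: "lin L" and L1: "L (\<lambda>_. 1) = 1" and La: "\<And>i. L (\<lambda>x. x $ i) = a $ i"
      and sq: "loc_nonneg L d (\<lambda>_. 1)" and bl: "loc_nonneg L d (ball_fun u \<delta>)" by auto
    have d1: "1 \<le> d" by (simp add: d_def)
    have sq1: "loc_nonneg L 1 (\<lambda>_. 1)" using sq d1 by (rule loc_nonneg_mono)
    have au: "norm (a - u) \<le> \<delta>" using barycentre_in_ball[OF L L1 La sq1 bl] \<delta> by simp
    define M where "M i j = L (\<lambda>x. (x $ i - a $ i) * (x $ j - a $ j))" for i j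
    have Msym: "M i j = M j i" for i j by (simp add: M_def mult.commute)
    define K where "K i j = qq i j u" for i j
    \<comment> \<open>The negated Hessian at \<open>u\<close>, symmetrized for the factorization,
      minus half of its definiteness margin; the other half keeps \<open>A\<close> positive
      definite.\<close>
    define A where "A i j = - (K i j + K j i) / 2 - (if i = j then \<epsilon> / 2 else 0)" for i j
    have swap: "(\<Sum>i\<in>UNIV. \<Sum>j\<in>UNIV. K j i * N i j) = (\<Sum>i\<in>UNIV. \<Sum>j\<in>UNIV. K i j * N i j)"
      if "\<And>i j. N i j = N j i" for N
      by (subst sum.swap) (simp add: that)
    have Aform: "(\<Sum>i\<in>UNIV. \<Sum>j\<in>UNIV. A i j * N i j) =
        - (\<Sum>i\<in>UNIV. \<Sum>j\<in>UNIV. K i j * N i j) - \<epsilon> / 2 * (\<Sum>i\<in>UNIV. N i i)"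
      if "\<And>i j. N i j = N j i" for N
    proof -
      have "(\<Sum>i\<in>UNIV. \<Sum>j\<in>UNIV. A i j * N i j) = (\<Sum>i\<in>UNIV. \<Sum>j\<in>UNIV.
          (- 1 / 2) * (K i j * N i j) + (- 1 / 2) * (K j i * N i j) - (if i = j then \<epsilon> / 2 * N i j else 0))"
        by (intro sum.cong refl) (simp add: A_def field_simps)
      also have "\<dots> = (- 1 / 2) * (\<Sum>i\<in>UNIV. \<Sum>j\<in>UNIV. K i j * N i j) +
          (- 1 / 2) * (\<Sum>i\<in>UNIV. \<Sum>j\<in>UNIV. K j i * N i j) - \<epsilon> / 2 * (\<Sum>i\<in>UNIV. N i i)"
        by (simp only: sum.distrib sum_subtractf sum_distrib_left) simp
      finally show ?thesis unfolding swap[of N, OF that] by simp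
    qed
    have "0 \<le> (\<Sum>i\<in>UNIV. \<Sum>j\<in>UNIV. A i j * M i j)"
      unfolding M_def
    proof (rule lin_quadratic_form_nonneg[OF L sq1])
      show "A i j = A j i" for i j by (simp add: A_def)
      fix z :: "'n \<Rightarrow> real" assume z: "\<exists>i\<in>UNIV. z i \<noteq> 0"
      define v where "v = (\<chi> i. z i)"
      have nv: "(norm v)\<^sup>2 = (\<Sum>i\<in>UNIV. z i * z i)"
        by (simp add: norm_vec_def L2_set_def sum_nonneg v_def power2_eq_square)
      have "v \<noteq> 0" using z by (auto simp: v_def vec_eq_iff)
      then have "0 < \<epsilon> / 2 * (norm v)\<^sup>2" using \<epsilon> by simp
      moreover have "(\<Sum>i\<in>UNIV. \<Sum>j\<in>UNIV. K i j * (z i * z j)) \<le> - \<epsilon> * (norm v)\<^sup>2"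
        using neg[of v] by (simp add: K_def v_def)
      ultimately show "0 < (\<Sum>i\<in>UNIV. \<Sum>j\<in>UNIV. A i j * (z i * z j))"
        by (subst Aform) (simp_all add: nv)
    qed
    then have main: "(\<Sum>i\<in>UNIV. \<Sum>j\<in>UNIV. K i j * M i j) \<le> - (\<epsilon> / 2 * (\<Sum>i\<in>UNIV. M i i))"
      by (subst (asm) Aform) (auto simp: Msym)
    show "L h \<le> h a"
    proof (rule lin_jensen[OF L L1 La h q qq])
      fix t :: real assume t: "0 \<le> t" "t \<le> 1"
      define F where "F i j x = qq i j (a + t *\<^sub>R (x - a)) - qq i j u" for i j x
      have err: "L (\<lambda>x. F i j x * ((x $ i - a $ i) * (x $ j - a $ j))) \<le> \<eta> / 2 * (M i i + M j j)" for i j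
      proof -
        have b: "loc_bound L 1 \<eta> (F i j)"
          unfolding F_def[abs_def] using dd[of i j] \<delta> \<delta>R[of i j] au t
          by (intro D[of \<delta> i j] L loc_nonneg_mono[OF sq] loc_nonneg_mono[OF bl]) auto
        then have b': "loc_bound L 1 \<eta> (\<lambda>x. - F i j x)" by (simp add: loc_bound_def)
        have pF: "pol (e' i j) (F i j)" unfolding F_def[abs_def]
          by (rule pol_diff[OF pol_affine_line[OF e'] pol_const])
        have pF': "pol (e' i j) (\<lambda>x. - F i j x)" using pol_scale[OF pF, of "-1"] by simp
        have sqe: "loc_nonneg L (1 + e' i j) (\<lambda>_. 1)" using dd[of i j] by (intro loc_nonneg_mono[OF sq]) simp
        \<comment> \<open>Polarization: the product of two coordinates of \<open>x - a\<close> has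
          no sign, but four times it is a difference of two squares. Testing
          \<open>\<eta> - F\<close> on one square and \<open>\<eta> + F\<close> on the other bounds
          the mixed term by diagonal moments.\<close>
        have "0 \<le> L (\<lambda>x. (\<eta> - F i j x) * ((x $ i - a $ i) + (x $ j - a $ j))\<^sup>2)"
          by (intro loc_nonnegD[OF loc_bound_imp_le[OF L sqe b pF \<eta>]] pol_add pol_diff pol_coord pol_const) auto
        moreover have "0 \<le> L (\<lambda>x. (\<eta> - - F i j x) * ((x $ i - a $ i) - (x $ j - a $ j))\<^sup>2)"
          by (intro loc_nonnegD[OF loc_bound_imp_le[OF L sqe b' pF' \<eta>]] pol_diff pol_coord pol_const) auto
        ultimately have "0 \<le> L (\<lambda>x. (\<eta> - F i j x) * ((x $ i - a $ i) + (x $ j - a $ j))\<^sup>2 +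
            (\<eta> - - F i j x) * ((x $ i - a $ i) - (x $ j - a $ j))\<^sup>2)"
          by (simp only: lin_add[OF L])
        also have "(\<lambda>x. (\<eta> - F i j x) * ((x $ i - a $ i) + (x $ j - a $ j))\<^sup>2 +
            (\<eta> - - F i j x) * ((x $ i - a $ i) - (x $ j - a $ j))\<^sup>2) =
            (\<lambda>x. ((2 * \<eta>) * ((x $ i - a $ i) * (x $ i - a $ i)) + (2 * \<eta>) * ((x $ j - a $ j) * (x $ j - a $ j)))
              - 4 * (F i j x * ((x $ i - a $ i) * (x $ j - a $ j))))"
          by (rule ext) (simp add: power2_eq_square algebra_simps)
        also have "L \<dots> = ((2 * \<eta>) * M i i + (2 * \<eta>) * M j j)
              - 4 * L (\<lambda>x. F i j x * ((x $ i - a $ i) * (x $ j - a $ j)))"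
          unfolding M_def by (simp only: lin_add[OF L] lin_diff[OF L] lin_scale[OF L])
        finally show ?thesis by (simp add: algebra_simps)
      qed
      have "L (\<lambda>x. \<Sum>i\<in>UNIV. \<Sum>j\<in>UNIV. qq i j (a + t *\<^sub>R (x - a)) * ((x $ i - a $ i) * (x $ j - a $ j))) =
          (\<Sum>i\<in>UNIV. \<Sum>j\<in>UNIV. K i j * M i j + L (\<lambda>x. F i j x * ((x $ i - a $ i) * (x $ j - a $ j))))"
      proof -
        have "(\<lambda>x. qq i j (a + t *\<^sub>R (x - a)) * ((x $ i - a $ i) * (x $ j - a $ j))) =
            (\<lambda>x. K i j * ((x $ i - a $ i) * (x $ j - a $ j)) + F i j x * ((x $ i - a $ i) * (x $ j - a $ j)))" for i j
          by (simp add: fun_eq_iff K_def F_def left_diff_distrib)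
        then show ?thesis unfolding M_def by (simp only: lin_sum[OF L] lin_add[OF L] lin_scale[OF L])
      qed
      also have "\<dots> = (\<Sum>i\<in>UNIV. \<Sum>j\<in>UNIV. K i j * M i j) +
          (\<Sum>i\<in>UNIV. \<Sum>j\<in>UNIV. L (\<lambda>x. F i j x * ((x $ i - a $ i) * (x $ j - a $ j))))"
        by (simp only: sum.distrib)
      also have "\<dots> \<le> - (\<epsilon> / 2 * (\<Sum>i\<in>UNIV. M i i)) + (\<Sum>i\<in>UNIV. \<Sum>j\<in>UNIV. \<eta> / 2 * (M i i + M j j))"
        by (intro add_mono main sum_mono err)
      also have "(\<Sum>i\<in>UNIV. \<Sum>j\<in>UNIV. \<eta> / 2 * (M i i + M j j)) = \<eta> * n * (\<Sum>i\<in>UNIV. M i i)"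
      proof -
        have "(\<Sum>i\<in>UNIV. \<Sum>j\<in>UNIV. \<eta> / 2 * (M i i + M j j)) = \<eta> / 2 * (\<Sum>i\<in>UNIV. \<Sum>j\<in>UNIV. M i i + M j j)"
          by (simp only: sum_distrib_left)
        also have "(\<Sum>i\<in>UNIV. \<Sum>j\<in>UNIV. M i i + M j j) = 2 * (n * (\<Sum>i\<in>UNIV. M i i))"
          by (simp add: sum.distrib n_def sum_distrib_left)
        finally show ?thesis by simp
      qed
      also have "\<eta> * n = \<epsilon> / 2" using n by (simp add: \<eta>_def)
      finally show "L (\<lambda>x. \<Sum>i\<in>UNIV. \<Sum>j\<in>UNIV.
          qq i j (a + t *\<^sub>R (x - a)) * ((x $ i - a $ i) * (x $ j - a $ j))) \<le> 0" by simp
    qed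
  qed
qed

section \<open>Local certificates and convex hulls\<close>

lemma real_polynomial_function_pos_near:
  fixes g :: "real^'n \<Rightarrow> real"
  assumes "real_polynomial_function g" "0 < g u"
  shows "\<exists>\<delta>>0. \<forall>x. norm (x - u) \<le> \<delta> \<longrightarrow> 0 < g x"
proof -
  obtain q where "has_partials g q" using real_polynomial_function_partials[OF assms(1)] by blast
  then have "isCont g u" unfolding has_partials_def using has_derivative_continuous by blast
  then obtain d where d: "0 < d" "\<And>x. dist x u < d \<Longrightarrow> dist (g x) (g u) < g u"
    using assms(2) unfolding continuous_at_eps_delta by blast
  have "0 < g x" if "norm (x - u) \<le> d / 2" for x
    using d(2)[of x] d(1) that by (auto simp: dist_norm)
  then show ?thesis using d(1) by (intro exI[of _ "d / 2"]) auto
qed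

lemma strictly_quasi_concave_penalty:
  assumes q: "has_partials g q" and qq: "\<And>i. has_partials (q i) (qq i)"
    and "strictly_quasi_concave_at g u"
  shows "\<exists>c \<epsilon>. 0 < \<epsilon> \<and> (\<forall>v. (\<Sum>i\<in>UNIV. \<Sum>j\<in>UNIV. qq i j u * (v $ i * v $ j))
      - 2 * c * (\<Sum>i\<in>UNIV. q i u * v $ i)\<^sup>2 \<le> - \<epsilon> * (norm v)\<^sup>2)"
proof (rule finsler_penalty)
  fix v :: "real^'a" assume v: "v \<noteq> 0" "(\<Sum>i\<in>UNIV. q i u * v $ i) = 0"
  have "grad g u \<bullet> v = 0" using v(2) by (simp add: inner_vec_def has_partials_grad[OF q])
  then have "v \<bullet> (hessian g u *v v) < 0"
    using assms(3) v(1) unfolding strictly_quasi_concave_at_def by force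
  moreover have "v \<bullet> (hessian g u *v v) = (\<Sum>i\<in>UNIV. \<Sum>j\<in>UNIV. qq i j u * (v $ i * v $ j))"
    by (simp add: inner_vec_def matrix_vector_mult_def has_partials_hessian[OF q qq] sum_distrib_left mult_ac)
  ultimately show "(\<Sum>i\<in>UNIV. \<Sum>j\<in>UNIV. qq i j u * (v $ i * v $ j)) < 0" by simp
qed

text \<open>The assertion covers every small \<open>\<delta>\<close> because the weights depend on
  \<open>\<delta>\<close>, while one radius must later serve all constraints of a piece. That
  \<open>a\<close> lies in the ball is assumed here, since it is certified once for the whole piece.
  If \<open>g u > 0\<close>, the ball alone forces the sign of \<open>g\<close> and \<open>C\<close>
  is empty.\<close>

lemma local_constraint_weights:
  fixes g :: "real^'n \<Rightarrow> real"
  assumes g: "real_polynomial_function g" and gu: "0 \<le> g u"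
    and conc: "g u = 0 \<Longrightarrow> sos_concave g \<or> strictly_quasi_concave_at g u"
  shows "\<exists>\<delta>0>0. \<forall>\<delta>. 0 < \<delta> \<and> \<delta> \<le> \<delta>0 \<longrightarrow> (\<exists>C. finite C \<and>
      (\<forall>x. norm (x - u) \<le> \<delta> \<and> 0 \<le> g x \<longrightarrow> (\<forall>(d, w)\<in>C. 0 \<le> w x)) \<and>
      (\<forall>L a. lin L \<and> L (\<lambda>_. 1) = 1 \<and> (\<forall>i. L (\<lambda>x. x $ i) = a $ i) \<and> norm (a - u) \<le> \<delta> \<and> sat L C
        \<longrightarrow> 0 \<le> g a))"
proof -
  obtain q where qpoly: "\<And>i. real_polynomial_function (q i)" and q: "has_partials g q"
    using real_polynomial_function_partials[OF g] by blast
  obtain qq where qqpoly: "\<And>i j. real_polynomial_function (qq i j)" and qq: "\<And>i. has_partials (q i) (qq i)"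
    using real_polynomial_function_partials[OF qpoly] by metis
  obtain e where e: "pol e g" using real_polynomial_function_imp_pol[OF g] by blast
  consider "0 < g u" | "sos_concave g" | "g u = 0" "strictly_quasi_concave_at g u"
    using gu conc by force
  then show ?thesis
  proof cases
    case 1
    obtain \<delta>0 where "\<delta>0 > 0" "\<And>x. norm (x - u) \<le> \<delta>0 \<Longrightarrow> 0 < g x"
      using real_polynomial_function_pos_near[of g u, OF g 1] by blast
    then show ?thesis
      by (intro exI[of _ \<delta>0] conjI allI impI exI[of _ "{}"]) (auto intro: less_imp_le)
  next
    case 2
    then obtain r W where W: "\<And>l i. l < r \<Longrightarrow> real_polynomial_function (W l i)"
      and sos: "\<And>x i j. (- hessian g x) $ i $ j = (\<Sum>l<(r::nat). W l i x * W l j x)"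
      unfolding sos_concave_def by blast
    have "\<forall>l i. \<exists>d. l < r \<longrightarrow> pol d (W l i)" using real_polynomial_function_imp_pol[OF W] by blast
    then obtain E where E: "\<And>l i. l < r \<Longrightarrow> pol (E l i) (W l i)" by metis
    define e' where "e' = (\<Sum>l<r. \<Sum>i\<in>UNIV. E l i)"
    have W': "pol e' (W l i)" if "l < r" for l i
    proof (rule pol_mono[OF E[OF that]])
      have "E l i \<le> (\<Sum>i\<in>UNIV. E l i)" by (rule member_le_sum) auto
      also have "\<dots> \<le> e'" unfolding e'_def by (rule member_le_sum[of l "{..<r}" "\<lambda>l. \<Sum>i\<in>UNIV. E l i"]) (use that in auto)
      finally show "E l i \<le> e'" .
    qed
    have sos': "- qq i j x = (\<Sum>l<r. W l i x * W l j x)" for i j x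
      using sos[of x i j] by (simp add: has_partials_hessian[OF q qq])
    have "0 \<le> g a" if "lin L" "L (\<lambda>_. 1) = 1" "\<And>i. L (\<lambda>x. x $ i) = a $ i"
      "sat L {(e' + 1, \<lambda>_. 1), (0, g)}" for L and a :: "real^'n"
    proof -
      have "L g \<le> g a"
        by (rule lin_jensen_sos[OF that(1-3) e q qq W' sos']) (use that(4) in \<open>auto simp: sat_def\<close>)
      moreover have "0 \<le> L g" using that(4) by (intro loc_nonneg_functional[of L 0]) (auto simp: sat_def)
      ultimately show ?thesis by simp
    qed
    then show ?thesis
      by (intro exI[of _ 1] conjI allI impI exI[of _ "{(e' + 1, \<lambda>_. 1), (0, g)}"]) auto
  next
    case 3
    obtain c \<epsilon> where \<epsilon>: "0 < \<epsilon>" and c: "\<And>v. (\<Sum>i\<in>UNIV. \<Sum>j\<in>UNIV. qq i j u * (v $ i * v $ j))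
      - 2 * c * (\<Sum>i\<in>UNIV. q i u * v $ i)\<^sup>2 \<le> - \<epsilon> * (norm v)\<^sup>2"
      using strictly_quasi_concave_penalty[OF q qq 3(2)] by blast
    \<comment> \<open>\<open>h = g - c g\<^sup>2\<close> has a negative definite Hessian at \<open>u\<close>, and the same sign as \<open>g\<close> near \<open>u\<close>.\<close>
    define s where "s x = 1 + (- c) * g x" for x
    define h where "h x = g x * s x" for x
    define p where "p i x = (1 + (- 2 * c) * g x) * q i x" for i x
    define pp where "pp i j x = (1 + (- 2 * c) * g x) * qq i j x + (- 2 * c) * q j x * q i x" for i j x
    have lin1: "has_partials (\<lambda>x. 1 + k * g x) (\<lambda>i x. k * q i x)" for k
      using has_partials_add[OF has_partials_const[of 1] has_partials_mult[OF has_partials_const[of k] q]] by simp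
    have hp: "has_partials h p"
      using has_partials_mult[OF q lin1[of "- c"]] unfolding h_def s_def p_def
      by (simp add: algebra_simps)
    have hpp: "has_partials (p i) (pp i)" for i
      using has_partials_mult[OF lin1[of "- 2 * c"] qq[of i]] unfolding p_def pp_def by simp
    have "real_polynomial_function (pp i j)" for i j
      unfolding pp_def using g qpoly qqpoly
      by (intro real_polynomial_function.intros(2-4))
    moreover have ppu: "(\<Sum>i\<in>UNIV. \<Sum>j\<in>UNIV. pp i j u * (v $ i * v $ j)) \<le> - \<epsilon> * (norm v)\<^sup>2" for v :: "real^'n"
    proof -
      have "(\<Sum>i\<in>UNIV. \<Sum>j\<in>UNIV. pp i j u * (v $ i * v $ j)) = (\<Sum>i\<in>UNIV. \<Sum>j\<in>UNIV.
          qq i j u * (v $ i * v $ j) - (2 * c) * ((q i u * v $ i) * (q j u * v $ j)))"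
        by (intro sum.cong refl) (simp add: pp_def 3(1) algebra_simps)
      also have "\<dots> = (\<Sum>i\<in>UNIV. \<Sum>j\<in>UNIV. qq i j u * (v $ i * v $ j)) - 2 * c * (\<Sum>i\<in>UNIV. q i u * v $ i)\<^sup>2"
        unfolding power2_eq_square sum_product by (simp only: sum_subtractf sum_distrib_left)
      finally show ?thesis using c by simp
    qed
    moreover have spoly: "pol e s" unfolding s_def[abs_def] by (intro pol_add pol_const pol_scale e)
    moreover have "pol (e + e) h" unfolding h_def[abs_def] by (rule pol_mult[OF e spoly order_refl])
    ultimately obtain d \<delta>1 where \<delta>1: "0 < \<delta>1" and jensen: "\<And>\<delta> L a. 0 < \<delta> \<and> \<delta> \<le> \<delta>1 \<and> lin L \<and> L (\<lambda>_. 1) = 1 \<and>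
      (\<forall>i. L (\<lambda>x. x $ i) = a $ i) \<and> loc_nonneg L d (\<lambda>_. 1) \<and> loc_nonneg L d (ball_fun u \<delta>) \<Longrightarrow> L h \<le> h a"
      using lin_jensen_near[OF _ hp hpp _ \<epsilon>, of "e + e" u] by blast
    obtain \<delta>2 where \<delta>2: "0 < \<delta>2" "\<And>x. norm (x - u) \<le> \<delta>2 \<Longrightarrow> 0 < s x"
      using real_polynomial_function_pos_near[OF pol_imp_real_polynomial_function[OF spoly], of u] 3(1)
      by (auto simp: s_def)
    show ?thesis
    proof (rule exI[of _ "min \<delta>1 \<delta>2"], intro conjI allI impI)
      fix \<delta> :: real assume \<delta>: "0 < \<delta> \<and> \<delta> \<le> min \<delta>1 \<delta>2"
      have "0 \<le> g a" if "lin L \<and> L (\<lambda>_. 1) = 1 \<and> (\<forall>i. L (\<lambda>x. x $ i) = a $ i) \<and> norm (a - u) \<le> \<delta> \<and>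
          sat L {(d, \<lambda>_. 1), (d, ball_fun u \<delta>), (0, h)}" for L a
      proof -
        have "L h \<le> h a" using that \<delta> by (intro jensen[of \<delta>]) (auto simp: sat_def)
        moreover have "0 \<le> L h" using that by (intro loc_nonneg_functional[of L 0]) (auto simp: sat_def)
        ultimately have "0 \<le> g a * s a" unfolding h_def by simp
        moreover have "0 < s a" using that \<delta> by (intro \<delta>2(2)) auto
        ultimately show ?thesis by (simp add: zero_le_mult_iff)
      qed
      moreover have "0 \<le> h x" if "norm (x - u) \<le> \<delta>" "0 \<le> g x" for x
        using that \<delta>2(2)[of x] \<delta> unfolding h_def by (auto intro!: mult_nonneg_nonneg)
      moreover have "0 \<le> ball_fun u \<delta> x" if "norm (x - u) \<le> \<delta>" for x
        using ball_fun_nonneg_iff[of \<delta> u x] that \<delta> by simp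
      ultimately show "\<exists>C. finite C \<and>
        (\<forall>x. norm (x - u) \<le> \<delta> \<and> 0 \<le> g x \<longrightarrow> (\<forall>(d, w)\<in>C. 0 \<le> w x)) \<and>
        (\<forall>L a. lin L \<and> L (\<lambda>_. 1) = 1 \<and> (\<forall>i. L (\<lambda>x. x $ i) = a $ i) \<and> norm (a - u) \<le> \<delta> \<and> sat L C
          \<longrightarrow> 0 \<le> g a)"
        by (intro exI[of _ "{(d, \<lambda>_. 1), (d, ball_fun u \<delta>), (0, h)}"] conjI) (force, force, blast)
    qed (use \<delta>1 \<delta>2 in auto)
  qed
qed

text \<open>Exactness of the relaxation: evaluations at points of \<open>K\<close> are feasible, and
  feasible functionals of mass one have their barycentre in \<open>K\<close>. Averaging two
  evaluations shows that a certified \<open>K\<close> is convex, although no \<open>T k\<close> is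
  assumed to be. The pair \<open>(1, \<lambda>_. 1)\<close> controls functionals of mass
  zero.\<close>

definition certifies :: "(nat \<times> (real^'n \<Rightarrow> real)) set \<Rightarrow> (real^'n) set \<Rightarrow> bool" where
  "certifies C K \<longleftrightarrow> finite C \<and> (1, \<lambda>_. 1) \<in> C \<and> (\<forall>x\<in>K. \<forall>(d, w)\<in>C. 0 \<le> w x) \<and>
     (\<forall>L. lin L \<and> L (\<lambda>_. 1) = 1 \<and> sat L C \<longrightarrow> (\<chi> i. L (\<lambda>x. x $ i)) \<in> K)"

lemma sat_combine:
  assumes "lin L" "sat L C" "lin M" "sat M C" "0 \<le> s" "0 \<le> t"
  shows "lin (\<lambda>f. s * L f + t * M f)" "sat (\<lambda>f. s * L f + t * M f) C"
proof -
  show "lin (\<lambda>f. s * L f + t * M f)"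
    using assms(1,3) by (simp add: lin_def algebra_simps)
  show "sat (\<lambda>f. s * L f + t * M f) C"
    using assms(2,4-6) unfolding sat_def loc_nonneg_def
    by (fastforce intro!: add_nonneg_nonneg mult_nonneg_nonneg)
qed

text \<open>A point of some \<open>K j\<close> is represented by its evaluation in component
  \<open>j\<close> and zero elsewhere. Conversely, components of positive mass are rescaled to mass
  one, their barycentres lie in the \<open>K j\<close>, and the masses are the coefficients of a
  convex combination.\<close>

lemma moment_hull_eq_convex_hull:
  fixes K :: "'j \<Rightarrow> (real^'n) set"
  assumes J: "finite J" and C: "\<And>j. j \<in> J \<Longrightarrow> certifies (C j) (K j)"
  shows "moment_hull J C = convex hull (\<Union>j\<in>J. K j)"
proof
  show "convex hull (\<Union>j\<in>J. K j) \<subseteq> moment_hull J C"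
  proof (rule hull_minimal)
    show "(\<Union>j\<in>J. K j) \<subseteq> moment_hull J C"
    proof
      fix x assume "x \<in> (\<Union>j\<in>J. K j)"
      then obtain j where j: "j \<in> J" "x \<in> K j" by blast
      define L where "L k f = (if k = j then 1 else 0) * f x" for k and f :: "real^'n \<Rightarrow> real"
      have "lin (L k)" for k unfolding L_def[abs_def] by (rule lin_eval)
      moreover have "sat (L k) (C k)" if "k \<in> J" for k
        using C[OF j(1)] j(2) unfolding sat_def loc_nonneg_def L_def certifies_def by fastforce
      moreover have "(\<Sum>k\<in>J. L k f) = f x" for f
        using J j(1) by (simp add: L_def if_distrib[of "\<lambda>c. c * _"] cong: if_cong)
      ultimately show "x \<in> moment_hull J C" unfolding moment_hull_def by blast
    qed
    show "convex (moment_hull J C)"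
    proof (rule convexI)
      fix x y :: "real^'n" and s t :: real
      assume st: "0 \<le> s" "0 \<le> t" "s + t = 1" and "x \<in> moment_hull J C" "y \<in> moment_hull J C"
      then obtain L M where L: "\<forall>j\<in>J. lin (L j) \<and> sat (L j) (C j)"
          "(\<Sum>j\<in>J. L j (\<lambda>_. 1)) = 1" "\<And>i. (\<Sum>j\<in>J. L j (\<lambda>x. x $ i)) = x $ i"
        and M: "\<forall>j\<in>J. lin (M j) \<and> sat (M j) (C j)"
          "(\<Sum>j\<in>J. M j (\<lambda>_. 1)) = 1" "\<And>i. (\<Sum>j\<in>J. M j (\<lambda>x. x $ i)) = y $ i"
        unfolding moment_hull_def by blast
      define N where "N j f = s * L j f + t * M j f" for j f
      have "\<forall>j\<in>J. lin (N j) \<and> sat (N j) (C j)"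
        unfolding N_def[abs_def] using L(1) M(1) st sat_combine by blast
      moreover have "(\<Sum>j\<in>J. N j f) = s * (\<Sum>j\<in>J. L j f) + t * (\<Sum>j\<in>J. M j f)" for f
        by (simp add: N_def sum.distrib sum_distrib_left)
      ultimately show "s *\<^sub>R x + t *\<^sub>R y \<in> moment_hull J C"
        unfolding moment_hull_def using L(2,3) M(2,3) st(3) by (intro CollectI exI[of _ N]) simp
    qed
  qed
  show "moment_hull J C \<subseteq> convex hull (\<Union>j\<in>J. K j)"
  proof
    fix x assume "x \<in> moment_hull J C"
    then obtain L where L: "\<And>j. j \<in> J \<Longrightarrow> lin (L j)" "\<And>j. j \<in> J \<Longrightarrow> sat (L j) (C j)"
        "(\<Sum>j\<in>J. L j (\<lambda>_. 1)) = 1" "\<And>i. (\<Sum>j\<in>J. L j (\<lambda>x. x $ i)) = x $ i"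
      unfolding moment_hull_def by blast
    define m where "m j = L j (\<lambda>_. 1)" for j
    have sq: "loc_nonneg (L j) 1 (\<lambda>_. 1)" if "j \<in> J" for j
      using C[OF that] L(2)[OF that] unfolding certifies_def sat_def by auto
    have m: "0 \<le> m j" if "j \<in> J" for j
      unfolding m_def using sq[OF that] by (rule loc_nonneg_functional)
    \<comment> \<open>Cauchy-Schwarz for a component without mass: \<open>L j\<close> of
      \<open>(x i + s)^2\<close> is affine in \<open>s\<close> and nonnegative for all
      \<open>s\<close>, so its slope vanishes. Otherwise such a component could move the barycentre
      without contributing to the convex combination.\<close>
    have zero: "L j (\<lambda>x. x $ i) = 0" if j: "j \<in> J" and mj: "m j = 0" for i j
    proof (rule ccontr)
      define b where "b = L j (\<lambda>x. x $ i)"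
      define c where "c = L j (\<lambda>x. (x $ i)\<^sup>2)"
      assume "L j (\<lambda>x. x $ i) \<noteq> 0"
      then have b: "b \<noteq> 0" by (simp add: b_def)
      have "0 \<le> L j (\<lambda>x. 1 * (x $ i + s)\<^sup>2)" for s
        by (rule loc_nonnegD[OF sq[OF j]]) (intro pol_add pol_coord pol_const, simp)
      moreover have "(\<lambda>x::real^'n. 1 * (x $ i + s)\<^sup>2) = (\<lambda>x. (x $ i)\<^sup>2 + (2 * s * x $ i + s\<^sup>2 * 1))" for s
        by (simp add: fun_eq_iff power2_eq_square algebra_simps)
      moreover have "L j (\<lambda>x. (x $ i)\<^sup>2 + (2 * s * x $ i + s\<^sup>2 * 1)) = c + (2 * s * b + s\<^sup>2 * m j)" for s
        unfolding b_def c_def m_def by (simp only: lin_add[OF L(1)[OF j]] lin_scale[OF L(1)[OF j]])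
      ultimately have "0 \<le> c + 2 * s * b" for s using mj by simp
      from this[of "- (c + 1) / (2 * b)"] show False using b by (simp add: field_simps)
    qed
    define I where "I = {j \<in> J. m j \<noteq> 0}"
    define y where "y j = (\<chi> i. L j (\<lambda>x. x $ i) / m j)" for j
    have yK: "y j \<in> K j" if "j \<in> I" for j
    proof -
      have j: "j \<in> J" and mj: "0 < m j" using that m[of j] by (auto simp: I_def)
      \<comment> \<open>The vanishing second term brings the rescaling into the form of
        \<open>sat_combine\<close>.\<close>
      define M where "M f = (1 / m j) * L j f + 0 * L j f" for f
      have "lin M" "sat M (C j)"
        unfolding M_def[abs_def] using L(1,2)[OF j] mj by (intro sat_combine; simp)+
      moreover have "M (\<lambda>_. 1) = 1" using mj by (simp add: M_def m_def)
      ultimately have "(\<chi> i. M (\<lambda>x. x $ i)) \<in> K j" using C[OF j] unfolding certifies_def by blast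
      then show ?thesis by (simp add: y_def M_def)
    qed
    have sumI: "(\<Sum>j\<in>I. f j) = (\<Sum>j\<in>J. f j)" if "\<And>j. j \<in> J \<Longrightarrow> m j = 0 \<Longrightarrow> f j = 0" for f :: "'j \<Rightarrow> real"
      unfolding I_def using J that by (intro sum.mono_neutral_left) auto
    have "(\<Sum>j\<in>I. m j *\<^sub>R y j) \<in> convex hull (\<Union>j\<in>J. K j)"
    proof (rule convex_sum)
      show "(\<Sum>j\<in>I. m j) = 1" using L(3) by (subst sumI) (auto simp: m_def)
      show "y j \<in> convex hull (\<Union>j\<in>J. K j)" if "j \<in> I" for j
        using yK[OF that] that by (intro hull_inc) (auto simp: I_def)
    qed (use J m in \<open>auto simp: I_def\<close>)
    moreover have "(\<Sum>j\<in>I. m j *\<^sub>R y j) = x"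
    proof (rule vec_eq_iff[THEN iffD2], rule allI)
      fix i
      have "(\<Sum>j\<in>I. m j *\<^sub>R y j) $ i = (\<Sum>j\<in>I. L j (\<lambda>x. x $ i))"
        by (auto simp: y_def I_def intro!: sum.cong)
      also have "\<dots> = x $ i" using L(4) zero by (subst sumI) auto
      finally show "(\<Sum>j\<in>I. m j *\<^sub>R y j) $ i = x $ i" .
    qed
    ultimately show "x \<in> convex hull (\<Union>j\<in>J. K j)" by simp
  qed
qed

section \<open>Certificates for the pieces and the covering of the boundary\<close>

lemma ex_uniform_radius:
  fixes P :: "'i \<Rightarrow> real \<Rightarrow> bool"
  assumes "finite I" "\<And>i. i \<in> I \<Longrightarrow> \<exists>\<delta>0>0. \<forall>\<delta>. 0 < \<delta> \<and> \<delta> \<le> \<delta>0 \<longrightarrow> P i \<delta>"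
  shows "\<exists>\<delta>>0. \<forall>i\<in>I. P i \<delta>"
proof -
  have "\<exists>\<delta>0>0. \<forall>\<delta>. 0 < \<delta> \<and> \<delta> \<le> \<delta>0 \<longrightarrow> (\<forall>i\<in>I. P i \<delta>)"
    using assms
  proof (induction I rule: finite_induct)
    case empty
    show ?case by (intro exI[of _ 1]) simp
  next
    case (insert i I)
    obtain a where "0 < a" "\<And>\<delta>. 0 < \<delta> \<and> \<delta> \<le> a \<Longrightarrow> P i \<delta>"
      using insert.prems[of i] by blast
    moreover obtain b where "0 < b" "\<And>\<delta>. 0 < \<delta> \<and> \<delta> \<le> b \<Longrightarrow> \<forall>i\<in>I. P i \<delta>"
      using insert.IH insert.prems by blast
    ultimately show ?case by (intro exI[of _ "min a b"]) auto
  qed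
  then show ?thesis by blast
qed

text \<open>The point \<open>u\<close> need not belong to the set, since every pair of a boundary
  point of \<open>S\<close> and an index \<open>k\<close> is treated alike. If it does not belong,
  the piece is empty for small radii; if it does, the weights of the single constraints are
  collected at a common radius.\<close>

lemma certifies_basic_closed_near:
  fixes h :: "nat \<Rightarrow> real^'n \<Rightarrow> real"
  assumes poly: "\<And>i. i \<in> {1..n} \<Longrightarrow> real_polynomial_function (h i)"
    and conc: "\<And>i. i \<in> {1..n} \<Longrightarrow> h i u = 0 \<Longrightarrow> sos_concave (h i) \<or> strictly_quasi_concave_at (h i) u"
  shows "\<exists>\<delta>>0. \<exists>C. certifies C (basic_closed_set n h \<inter> cball u \<delta>)"
proof (cases "u \<in> basic_closed_set n h")
  case False
  then obtain i where i: "i \<in> {1..n}" "h i u < 0" by (auto simp: basic_closed_set_def not_le)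
  have "real_polynomial_function (\<lambda>x. (-1) * h i x)"
    by (intro real_polynomial_function.intros(2,4) poly i)
  from real_polynomial_function_pos_near[OF this, of u] i(2)
  obtain \<delta> where \<delta>: "0 < \<delta>" "\<And>x. norm (x - u) \<le> \<delta> \<Longrightarrow> h i x < 0" by auto
  have "basic_closed_set n h \<inter> cball u \<delta> = {}"
    using \<delta>(2) i(1) by (force simp: basic_closed_set_def dist_norm norm_minus_commute)
  \<comment> \<open>The constant weight -1 is violated by every functional of mass one; within a
    convex hull it forces the mass of the empty piece to be zero.\<close>
  moreover have "certifies {(1, \<lambda>_. 1), (0, \<lambda>_. -1)} ({} :: (real^'n) set)"
  proof -
    have nosat: "\<not> sat L {(1, \<lambda>_. 1), (0, \<lambda>_. -1)}" if "lin L" "L (\<lambda>_. 1) = 1" for L :: "(real^'n \<Rightarrow> real) \<Rightarrow> real"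
      using lin_scale[OF that(1), of "-1" "\<lambda>_. 1"] that(2) loc_nonneg_functional[of L 0 "\<lambda>_. -1"]
      by (auto simp: sat_def)
    show ?thesis unfolding certifies_def
    proof (intro conjI allI impI)
      fix L :: "(real^'n \<Rightarrow> real) \<Rightarrow> real"
      assume "lin L \<and> L (\<lambda>_. 1) = 1 \<and> sat L {(1, \<lambda>_. 1), (0, \<lambda>_. -1)}"
      then show "(\<chi> i. L (\<lambda>x. x $ i)) \<in> {}" using nosat[of L] by blast
    qed simp_all
  qed
  ultimately have "certifies {(1, \<lambda>_. 1), (0, \<lambda>_. -1)} (basic_closed_set n h \<inter> cball u \<delta>)"
    by (simp only:)
  then show ?thesis using \<delta>(1) by blast
next
  case True
  define Q where "Q i \<delta> C \<longleftrightarrow> finite C \<and>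
      (\<forall>x. norm (x - u) \<le> \<delta> \<and> 0 \<le> h i x \<longrightarrow> (\<forall>(d, w)\<in>C. 0 \<le> w x)) \<and>
      (\<forall>L a. lin L \<and> L (\<lambda>_. 1) = 1 \<and> (\<forall>i. L (\<lambda>x. x $ i) = a $ i) \<and> norm (a - u) \<le> \<delta> \<and> sat L C
        \<longrightarrow> 0 \<le> h i a)" for i \<delta> C
  have "\<exists>\<delta>>0. \<forall>i\<in>{1..n}. \<exists>C. Q i \<delta> C"
  proof (rule ex_uniform_radius)
    fix i assume i: "i \<in> {1..n}"
    show "\<exists>\<delta>0>0. \<forall>\<delta>. 0 < \<delta> \<and> \<delta> \<le> \<delta>0 \<longrightarrow> (\<exists>C. Q i \<delta> C)"
      unfolding Q_def using True i
      by (intro local_constraint_weights poly conc) (auto simp: basic_closed_set_def)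
  qed simp
  then obtain \<delta> where \<delta>: "0 < \<delta>" and "\<forall>i\<in>{1..n}. \<exists>C. Q i \<delta> C" by blast
  from bchoice[OF this(2)] obtain C where C: "\<And>i. i \<in> {1..n} \<Longrightarrow> Q i \<delta> (C i)" by blast
  \<comment> \<open>Besides the weights of the constraints, exactly what
    \<open>barycentre_in_ball\<close> uses to place \<open>a\<close> in the ball, as the conditions
    \<open>Q\<close> presuppose.\<close>
  define D where "D = {(1, \<lambda>_. 1), (1, ball_fun u \<delta>)} \<union> (\<Union>i\<in>{1..n}. C i)"
  have "certifies D (basic_closed_set n h \<inter> cball u \<delta>)"
    unfolding certifies_def
  proof (intro conjI ballI allI impI)
    show "finite D" unfolding D_def using C by (auto simp: Q_def)
    show "(1, \<lambda>_. 1) \<in> D" by (simp add: D_def)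
  next
    fix x c assume x: "x \<in> basic_closed_set n h \<inter> cball u \<delta>" and c: "c \<in> D"
    have n: "norm (x - u) \<le> \<delta>" using x by (simp add: dist_norm norm_minus_commute)
    consider "c = (1, \<lambda>_. 1)" | "c = (1, ball_fun u \<delta>)" | i where "i \<in> {1..n}" "c \<in> C i"
      using c by (auto simp: D_def)
    then show "case c of (d, w) \<Rightarrow> 0 \<le> w x"
    proof cases
      case 2
      then show ?thesis using n \<delta> ball_fun_nonneg_iff[of \<delta> u x] by simp
    next
      case 3
      then show ?thesis using C[OF 3(1)] n x unfolding Q_def basic_closed_set_def by blast
    qed simp
  next
    fix L assume L: "lin L \<and> L (\<lambda>_. 1) = 1 \<and> sat L D"
    define a where "a = (\<chi> i. L (\<lambda>x. x $ i))"
    have La: "L (\<lambda>x. x $ i) = a $ i" for i by (simp add: a_def)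
    have "loc_nonneg L 1 (\<lambda>_. 1)" "loc_nonneg L 1 (ball_fun u \<delta>)"
      using L by (auto simp: sat_def D_def)
    then have n: "norm (a - u) \<le> \<delta>"
      using L La \<delta> by (intro barycentre_in_ball[of L a 1]) auto
    have "0 \<le> h i a" if i: "i \<in> {1..n}" for i
    proof -
      have "sat L (C i)" using L i by (auto simp: sat_def D_def)
      then show ?thesis using C[OF i] L La n unfolding Q_def by blast
    qed
    then show "a \<in> basic_closed_set n h \<inter> cball u \<delta>"
      using n by (simp add: basic_closed_set_def dist_norm norm_minus_commute)
  qed
  then show ?thesis using \<delta> by blast
qed

theorem theorem3p4:
  fixes S :: "(real^'n) set"
    and m :: nat
    and T :: "nat \<Rightarrow> (real^'n) set"
    and mk :: "nat \<Rightarrow> nat"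
    and g :: "nat \<Rightarrow> nat \<Rightarrow> real^'n \<Rightarrow> real"
  assumes "\<And>k i. k \<in> {1..m} \<Longrightarrow> i \<in> {1..mk k} \<Longrightarrow> real_polynomial_function (g k i)"
    and "\<And>k. k \<in> {1..m} \<Longrightarrow> T k = basic_closed_set (mk k) (g k)"
    and "S = (\<Union>k\<in>{1..m}. T k)"
    and "compact S" and "convex S" and "semialgebraic S"
    and "\<And>u k i. u \<in> frontier S \<Longrightarrow> k \<in> {1..m} \<Longrightarrow> i \<in> {1..mk k} \<Longrightarrow> g k i u = 0 \<Longrightarrow>
           has_interior_near (mk k) (g k) u \<and>
           (sos_concave (g k i) \<or> strictly_quasi_concave_at (g k i) u)"
  shows "sdp_representable S"
proof -
  have "\<forall>c\<in>frontier S \<times> {1..m}. \<exists>p. 0 < fst p \<and> certifies (snd p) (T (snd c) \<inter> cball (fst c) (fst p))"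
  proof
    fix c assume "c \<in> frontier S \<times> {1..m}"
    then have c: "fst c \<in> frontier S" "snd c \<in> {1..m}" by auto
    have "\<exists>\<delta>>0. \<exists>C. certifies C (T (snd c) \<inter> cball (fst c) \<delta>)"
      unfolding assms(2)[OF c(2)] using assms(1)[OF c(2)] assms(7)[OF c]
      by (intro certifies_basic_closed_near) blast+
    then show "\<exists>p. 0 < fst p \<and> certifies (snd p) (T (snd c) \<inter> cball (fst c) (fst p))" by auto
  qed
  from bchoice[OF this] obtain p where p: "\<And>u k. u \<in> frontier S \<Longrightarrow> k \<in> {1..m} \<Longrightarrow>
      0 < fst (p (u, k)) \<and> certifies (snd (p (u, k))) (T k \<inter> cball u (fst (p (u, k))))"
    by fastforce
  \<comment> \<open>One radius below those of all \<open>T k\<close> at \<open>u\<close>: a boundary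
    point in this ball lies in some \<open>T k\<close>, hence in the corresponding piece, whichever
    \<open>k\<close> occurs. The inserted 1 keeps the set nonempty when
    \<open>m = 0\<close>.\<close>
  define r where "r u = Min (insert 1 ((\<lambda>k. fst (p (u, k))) ` {1..m}))" for u
  have r: "0 < r u" if "u \<in> frontier S" for u
    unfolding r_def using p[OF that] by (subst Min_gr_iff) auto
  have rk: "r u \<le> fst (p (u, k))" if "k \<in> {1..m}" for u k
    unfolding r_def using that by (intro Min_le) auto
  have "compact (frontier S)" using assms(4) by (simp add: compact_frontier)
  moreover have "frontier S \<subseteq> (\<Union>u\<in>frontier S. ball u (r u))" using r by force
  ultimately obtain F where F: "F \<subseteq> frontier S" "finite F" "frontier S \<subseteq> (\<Union>u\<in>F. ball u (r u))"
    by (rule compactE_image[OF _ open_ball]) blast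
  define J where "J = F \<times> {1..m}"
  define K where "K c = T (snd c) \<inter> cball (fst c) (fst (p c))" for c
  have cert: "certifies (snd (p c)) (K c)" if "c \<in> J" for c
    using p[of "fst c" "snd c"] that F(1) by (auto simp: J_def K_def)
  have J: "finite J" using F(2) by (simp add: J_def)
  have frS: "frontier S \<subseteq> S" using assms(4) by (simp add: frontier_subset_compact)
  have frK: "frontier S \<subseteq> (\<Union>c\<in>J. K c)"
  proof
    fix x assume x: "x \<in> frontier S"
    then obtain u where u: "u \<in> F" "dist u x < r u" using F(3) by auto
    obtain k where k: "k \<in> {1..m}" "x \<in> T k" using x frS assms(3) by blast
    have "x \<in> K (u, k)" using u(2) k(2) rk[OF k(1), of u] by (simp add: K_def)
    then show "x \<in> (\<Union>c\<in>J. K c)" using u(1) k(1) unfolding J_def by blast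
  qed
  have "convex hull (\<Union>c\<in>J. K c) = S"
  proof
    have "(\<Union>c\<in>J. K c) \<subseteq> S" unfolding assms(3) by (auto simp: J_def K_def)
    then show "convex hull (\<Union>c\<in>J. K c) \<subseteq> S" using assms(5) by (rule hull_minimal)
    \<comment> \<open>An extreme point is not interior, so covering the boundary already catches all
      extreme points.\<close>
    have "{x. x extreme_point_of S} \<subseteq> frontier S"
      using assms(4) by (auto simp: frontier_def extreme_point_not_in_interior extreme_point_of_def
          dest: compact_imp_closed)
    then have "convex hull {x. x extreme_point_of S} \<subseteq> convex hull (\<Union>c\<in>J. K c)"
      using frK by (intro hull_mono) blast
    then show "S \<subseteq> convex hull (\<Union>c\<in>J. K c)"
      using Krein_Milman_Minkowski[OF assms(4,5)] by simp
  qed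
  then have "S = moment_hull J (\<lambda>c. snd (p c))"
    using moment_hull_eq_convex_hull[OF J cert] by simp
  moreover have "finite (snd (p c))" if "c \<in> J" for c
    using cert[OF that] by (simp add: certifies_def)
  ultimately show ?thesis
    using sdp_representable_moment_hull[OF J, of "\<lambda>c. snd (p c)"] by simp
qed

end
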